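(* Let $n\ge 2$ and $\varphi\in\Phi$. If $K,L$ are compact convex sets in $\mathbb{R}^n$ with $o\in\operatorname{int}K$ and $o\in L$, then $$V_\varphi(K,L)\ge V(K)\,\varphi\left(\left(\frac{V(L)}{V(K)}\right)^{1/n}\right).$$ If $\varphi$ is strictly convex, equality holds if and only if $K$ and $L$ are dilatates or $L=\{o\}$.
   Context: $\Phi$ is the set of convex functions $\varphi:[0,\infty)\to[0,\infty)$ that are increasing (i.e. nondecreasing) and satisfy $\varphi(0)=0$ and $\varphi(1)=1$. $V$ is $n$-dimensional volume, $h_K(x)=\sup\{x\cdot y:y\in K\}$ is the support function, and $S(K,\cdot)$ is the surface area measure of $K$ on $S^{n-1}$. $K$ and $L$ are dilatates if $L=tK$ for some $t>0$. The Orlicz mixed volume is $$V_\varphi(K,L)=\frac1n\int_{S^{n-1}}\varphi\left(\frac{h_L(u)}{h_K(u)}\right)h_K(u)\,dS(K,u).$$ *)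

theory Defs
  imports "HOL-Analysis.Analysis"
begin

definition Orlicz_class :: "(real \<Rightarrow> real) set" where
  "Orlicz_class = {\<phi>. convex_on {0..} \<phi> \<and> mono_on {0..} \<phi> \<and> (\<forall>t\<ge>0. 0 \<le> \<phi> t) \<and> \<phi> 0 = 0 \<and> \<phi> 1 = 1}"

definition strictly_convex_on :: "'a::real_vector set \<Rightarrow> ('a \<Rightarrow> real) \<Rightarrow> bool" where
  "strictly_convex_on S f \<longleftrightarrow> convex S \<and>
     (\<forall>x\<in>S. \<forall>y\<in>S. \<forall>u>0. \<forall>v>0. x \<noteq> y \<longrightarrow> u + v = 1 \<longrightarrow>
        f (u *\<^sub>R x + v *\<^sub>R y) < u * f x + v * f y)"

definition support_function :: "'a::real_inner set \<Rightarrow> 'a \<Rightarrow> real" where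
  "support_function K x = (SUP y\<in>K. x \<bullet> y)"

definition dilatates :: "'a::real_vector set \<Rightarrow> 'a set \<Rightarrow> bool" where
  "dilatates K L \<longleftrightarrow> (\<exists>t>0. L = (\<lambda>x. t *\<^sub>R x) ` K)"

text \<open>
  For a closed convex set \<open>K\<close>, the points outside \<open>K\<close> at distance at most \<open>\<rho>\<close> from \<open>K\<close> whose
  outer unit normal, pointing from the nearest point of \<open>K\<close>, lies in \<open>\<omega>\<close>.
\<close>

definition local_parallel_set :: "'a::euclidean_space set \<Rightarrow> real \<Rightarrow> 'a set \<Rightarrow> 'a set" where
  "local_parallel_set K \<rho> \<omega> =
     {x. 0 < infdist x K \<and> infdist x K \<le> \<rho> \<and> sgn (x - closest_point K x) \<in> \<omega>}"

text \<open>
  The surface area measure is the area measure of order \<open>n - 1\<close> of Fenchel and Jessen (see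
  Schneider, Convex Bodies: The Brunn-Minkowski Theory, Section 4.2), defined by the local Steiner
  formula: for a compact convex \<open>K\<close> and a Borel set \<open>\<omega>\<close> in the unit sphere, the volume of
  \<open>local_parallel_set K \<rho> \<omega>\<close> is a polynomial in \<open>\<rho> > 0\<close> without constant term, and the coefficient
  of \<open>\<rho>\<close>, i.e. the limit below, is \<open>S(K, \<omega>)\<close>.  It is countably additive in \<open>\<omega>\<close>, so that
  \<open>measure_of\<close> does not fall back to the null measure.  If \<open>K\<close> has interior points, then \<open>S(K, \<omega>)\<close>
  is the \<open>(n - 1)\<close>-dimensional Hausdorff measure of the set of boundary points of \<open>K\<close> that have an
  outer unit normal in \<open>\<omega>\<close>.
\<close>

definition surface_area_measure :: "'a::euclidean_space set \<Rightarrow> 'a measure" where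
  "surface_area_measure K =
     measure_of (sphere 0 1) (sets (restrict_space borel (sphere 0 1)))
       (\<lambda>\<omega>. Lim (at_right 0) (\<lambda>\<rho>. emeasure lebesgue (local_parallel_set K \<rho> \<omega>) / ennreal \<rho>))"

definition Orlicz_mixed_volume :: "(real \<Rightarrow> real) \<Rightarrow> 'a::euclidean_space set \<Rightarrow> 'a set \<Rightarrow> real" where
  "Orlicz_mixed_volume \<phi> K L =
     (1 / real DIM('a)) *
     (\<integral>u. \<phi> (support_function L u / support_function K u) * support_function K u
        \<partial>surface_area_measure K)"

end

theory Submission
  imports Defs
begin

text \<open>
  Let \<open>d\<close> be the distance from \<open>K\<close> and \<open>N\<close> the outer normal pointing from the nearest point of \<open>K\<close>.
  On \<open>{d > t}\<close> the inward shift \<open>x \<mapsto> x - t N(x)\<close> is nonexpansive, so the volume of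
  \<open>{a < d \<le> a + h, N \<in> \<omega>}\<close> increases with \<open>a\<close>.  Hence the volume of the local parallel set divided by
  \<open>\<rho>\<close> increases with \<open>\<rho>\<close>, its limit \<open>S(K, \<omega>)\<close> exists, and continuity at the empty set is inherited from
  \<open>\<rho> = 1\<close>, which makes \<open>S(K, \<cdot>)\<close> a measure.

  For \<open>z \<in> K + \<epsilon>L\<close> outside \<open>K\<close> one has \<open>d(z) \<le> \<epsilon> h\<^sub>L(N(z))\<close>; together with the Brunn-Minkowski inequality
  (Hadwiger and Ohmann's proof by cutting boxes) this gives Minkowski's first inequality
  \<open>\<integral> h\<^sub>L dS(K) \<ge> n V(K)\<^bsup>1 - 1/n\<^esup> V(L)\<^bsup>1/n\<^esup>\<close>.  Conversely, \<open>K\<^sub>\<rho> / (1 + \<epsilon>)\<close> does not meet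
  \<open>{\<rho> - \<epsilon> h\<^sub>K(N) < d \<le> \<rho>}\<close>, where \<open>K\<^sub>\<rho> = {d \<le> \<rho>}\<close>; hence \<open>\<integral> h\<^sub>K dS(K) \<le> n V(K)\<close>.
  Integrating a supporting line of \<open>\<phi>\<close> at \<open>s = (V(L) / V(K))\<^bsup>1/n\<^esup>\<close> proves the inequality.

  In the equality case strict convexity forces \<open>h\<^sub>L = s h\<^sub>K\<close> almost everywhere.  The two integral
  inequalities applied to the convex hull of the union show that \<open>h\<^sub>L \<le> h\<^sub>K\<close> almost everywhere
  implies \<open>L \<subseteq> K\<close>, so \<open>L \<subseteq> sK\<close>; these bodies have equal volume.  No equality case of the
  Brunn-Minkowski inequality is needed.
\<close>

section \<open>Shells around a convex body\<close>

lemma measure_nonexpansive_image_le: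
  fixes f :: "'a::euclidean_space \<Rightarrow> 'a"
  assumes A: "A \<in> lmeasurable" and B: "B \<in> lmeasurable" "B \<subseteq> f ` A"
    and lip: "\<And>x y. x \<in> A \<Longrightarrow> y \<in> A \<Longrightarrow> norm (f x - f y) \<le> norm (x - y)"
  shows "measure lebesgue B \<le> measure lebesgue A"
proof (rule field_le_epsilon)
  fix e :: real
  assume "e > 0"
  obtain U where U: "open U" "A \<subseteq> U" "U - A \<in> lmeasurable"
      "emeasure lebesgue (U - A) < ennreal e"
    using sets_lebesgue_outer_open[OF fmeasurableD[OF A] \<open>e > 0\<close>] by blast
  have Ueq: "U = A \<union> (U - A)"
    using U by blast
  have Um: "U \<in> lmeasurable"
    using Ueq A U(3) by (metis fmeasurable.Un)
  have "measure lebesgue (U - A) < e"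
    using U(3,4) \<open>e > 0\<close> by (simp add: emeasure_eq_measure2 ennreal_less_iff)
  moreover have "measure lebesgue U \<le> measure lebesgue A + measure lebesgue (U - A)"
    by (subst Ueq, rule measure_Un_le) (use A U in \<open>auto intro: fmeasurableD\<close>)
  ultimately have Ue: "measure lebesgue U \<le> measure lebesgue A + e"
    by simp
  \<comment> \<open>Indices are pairs of centre and radius. The centres lie in \<open>A\<close>
    because \<open>f\<close> is controlled only on \<open>A\<close>.\<close>
  define I where "I = {(x, r). x \<in> A \<and> 0 < r \<and> cball x r \<subseteq> U}"
  obtain C where C: "countable C" "C \<subseteq> I"
     "pairwise (\<lambda>i j. disjnt (cball (fst i) (snd i)) (cball (fst j) (snd j))) C"
     "negligible (A - (\<Union>i\<in>C. cball (fst i) (snd i)))"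
  proof (rule Vitali_covering_theorem_cballs[of I snd A fst])
    show "0 < snd i" if "i \<in> I" for i
      using that by (auto simp: I_def)
    show "\<exists>i. i \<in> I \<and> x \<in> cball (fst i) (snd i) \<and> snd i < d" if x: "x \<in> A" and d: "0 < d" for x d
    proof -
      have "x \<in> U" using x U by blast
      then obtain e where e: "e > 0" "cball x e \<subseteq> U"
        using U(1) open_contains_cball by blast
      have "cball x (min e (d/2)) \<subseteq> cball x e" by auto
      then have "(x, min e (d/2)) \<in> I"
        using e x d by (auto simp: I_def)
      then show ?thesis
        using e d by (intro exI[of _ "(x, min e (d/2))"]) auto
    qed
  qed
  define N where "N = A - (\<Union>i\<in>C. cball (fst i) (snd i))"
  have fN: "negligible (f ` N)"
  proof (rule negligible_locally_Lipschitz_image)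
    show "\<exists>T B. open T \<and> x \<in> T \<and> (\<forall>y\<in>N \<inter> T. norm (f y - f x) \<le> B * norm (y - x))" if "x \<in> N" for x
      using that lip by (intro exI[of _ UNIV] exI[of _ 1]) (auto simp: N_def)
  qed (use C in \<open>auto simp: N_def\<close>)
  define W where "W = (\<Union>i\<in>C. cball (f (fst i)) (snd i))"
  \<comment> \<open>The translated balls may overlap, so only subadditivity applies to them; the
    original balls are disjoint, so their volumes add up inside \<open>U\<close>. Finite subfamilies
    suffice to bound the countable union.\<close>
  have bound: "measure lebesgue (\<Union>i\<in>J. cball (f (fst i)) (snd i)) \<le> measure lebesgue U"
    if J: "J \<subseteq> C" "finite J" for J
  proof -
    have "measure lebesgue (\<Union>i\<in>J. cball (f (fst i)) (snd i))
        \<le> (\<Sum>i\<in>J. measure lebesgue (cball (f (fst i)) (snd i)))"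
      by (rule measure_UNION_le) (use J in auto)
    also have "\<dots> = (\<Sum>i\<in>J. measure lebesgue (cball (fst i) (snd i)))"
    proof (rule sum.cong)
      fix i assume "i \<in> J"
      have "(+) (f (fst i) - fst i) ` cball (fst i) (snd i) = cball (f (fst i)) (snd i)"
        by (simp add: cball_translation[symmetric])
      then show "measure lebesgue (cball (f (fst i)) (snd i)) = measure lebesgue (cball (fst i) (snd i))"
        by (metis measure_translation)
    qed simp
    also have "\<dots> = measure lebesgue (\<Union>i\<in>J. cball (fst i) (snd i))"
    proof (rule measure_finite_Union[symmetric])
      show "disjoint_family_on (\<lambda>i. cball (fst i) (snd i)) J"
        using C(3) J by (force simp: disjoint_family_on_def pairwise_def disjnt_def)
    qed (use J in \<open>auto simp: less_imp_neq emeasure_lborel_cball_finite[unfolded infinity_ennreal_def]\<close>)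
    also have "\<dots> \<le> measure lebesgue U"
    proof (rule measure_mono_fmeasurable)
      have "cball (fst i) (snd i) \<subseteq> U" if "i \<in> J" for i
      proof -
        have "i \<in> I" using that J(1) C(2) by blast
        then show ?thesis by (simp add: I_def case_prod_beta)
      qed
      then show "(\<Union>i\<in>J. cball (fst i) (snd i)) \<subseteq> U" by blast
    qed (use J Um in auto)
    finally show ?thesis .
  qed
  have W: "W \<in> lmeasurable" "measure lebesgue W \<le> measure lebesgue U"
    unfolding W_def
    by (rule fmeasurable_UN_bound[OF C(1) _ bound] measure_UN_bound[OF C(1) _ bound]; simp)+
  have "B \<subseteq> W \<union> f ` N"
  proof
    fix b assume "b \<in> B"
    then obtain x where x: "x \<in> A" "b = f x" using B by blast
    show "b \<in> W \<union> f ` N"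
    proof (cases "x \<in> N")
      case False
      then obtain i where i: "i \<in> C" "x \<in> cball (fst i) (snd i)"
        using x by (auto simp: N_def)
      then have "i \<in> I" using C(2) by blast
      then have "fst i \<in> A" by (simp add: I_def case_prod_beta)
      then have "f x \<in> cball (f (fst i)) (snd i)"
        using lip[of "fst i" x] x i by (simp add: dist_norm)
      then show ?thesis
        unfolding W_def x using i by blast
    qed (use x in blast)
  qed
  then have "measure lebesgue B \<le> measure lebesgue (W \<union> f ` N)"
    by (intro measure_mono_fmeasurable fmeasurable.Un fmeasurableD[OF B(1)] W(1)
        negligible_imp_measurable[OF fN])
  also have "\<dots> \<le> measure lebesgue W + measure lebesgue (f ` N)"
    by (intro measure_Un_le fmeasurableD W(1) negligible_imp_measurable[OF fN])
  also have "\<dots> \<le> measure lebesgue A + e"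
    using W Ue fN by (simp add: negligible_imp_measure0)
  finally show "measure lebesgue B \<le> measure lebesgue A + e" .
qed

section \<open>Nearest points, outer normals and shells\<close>

definition outer_normal :: "'a::euclidean_space set \<Rightarrow> 'a \<Rightarrow> 'a" where
  "outer_normal K x = sgn (x - closest_point K x)"

text \<open>Distances range over the half-open interval from \<open>a\<close> to \<open>b\<close>,
  so that consecutive shells are disjoint and their volumes add.\<close>

definition shell :: "'a::euclidean_space set \<Rightarrow> real \<Rightarrow> real \<Rightarrow> 'a set \<Rightarrow> 'a set" where
  "shell K a b \<omega> = {x. a < infdist x K \<and> infdist x K \<le> b \<and> outer_normal K x \<in> \<omega>}"

lemma local_parallel_set_eq_shell: "local_parallel_set K \<rho> \<omega> = shell K 0 \<rho> \<omega>"
  by (auto simp: local_parallel_set_def shell_def outer_normal_def)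

lemma infdist_eq_dist_closest_point:
  assumes "closed K" "K \<noteq> {}"
  shows "infdist x K = dist x (closest_point K x)"
proof (rule antisym)
  show "infdist x K \<le> dist x (closest_point K x)"
    using assms by (simp add: closest_point_in_set infdist_le)
  show "dist x (closest_point K x) \<le> infdist x K"
    using assms by (simp add: infdist_notempty cINF_greatest closest_point_le)
qed

locale convex_body =
  fixes K :: "'a::euclidean_space set"
  assumes compact_K: "compact K" and convex_K: "convex K" and nonempty_K: "K \<noteq> {}"
begin

abbreviation "P \<equiv> closest_point K"
abbreviation "d x \<equiv> infdist x K"
abbreviation "N \<equiv> outer_normal K"

lemma closed_K: "closed K"
  using compact_K by (rule compact_imp_closed)

lemma P_in: "P x \<in> K"
  using closed_K nonempty_K by (rule closest_point_in_set)

lemma d_eq: "d x = norm (x - P x)"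
  using infdist_eq_dist_closest_point[OF closed_K nonempty_K] by (simp add: dist_norm)

lemma norm_N: "0 < d x \<Longrightarrow> norm (N x) = 1"
  by (auto simp: outer_normal_def d_eq norm_sgn)

lemma decomp: "x = P x + d x *\<^sub>R N x"
  by (cases "x = P x") (simp_all add: outer_normal_def d_eq sgn_div_norm)

text \<open>The hyperplane through \<open>P x\<close> orthogonal to \<open>x - P x\<close> supports
  \<open>K\<close>, so \<open>N x\<close> is an outer normal at \<open>P x\<close>. For
  \<open>x\<close> in \<open>K\<close> the vector \<open>N x\<close> is \<open>sgn 0 = 0\<close> and
  the claim is trivial.\<close>

lemma N_inner_le: "y \<in> K \<Longrightarrow> N x \<bullet> y \<le> N x \<bullet> P x"
  using closest_point_dot[OF convex_K closed_K, of y x]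
  by (simp add: outer_normal_def sgn_div_norm inner_diff_right divide_simps mult_left_mono)

lemma inner_N_decomp: "0 < d x \<Longrightarrow> N x \<bullet> x = N x \<bullet> P x + d x"
  using norm_N[of x] by (subst (2) decomp) (simp add: inner_add_right norm_eq_1)

text \<open>The supporting hyperplane at \<open>P y\<close> separates \<open>K\<close> from the
  outer ray through \<open>y\<close>: at height \<open>r\<close> on the ray every point of
  \<open>K\<close> is at distance at least \<open>r\<close>, attained at \<open>P y\<close>. Points
  can thus be moved along their normals without changing \<open>P\<close> and
  \<open>N\<close>.\<close>

lemma along_normal:
  assumes "0 < d y" "0 < r"
  shows "P (P y + r *\<^sub>R N y) = P y" "d (P y + r *\<^sub>R N y) = r" "N (P y + r *\<^sub>R N y) = N y"
proof -
  let ?x = "P y + r *\<^sub>R N y"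
  have "dist ?x (P y) \<le> dist ?x z" if "z \<in> K" for z
  proof -
    have "r \<le> N y \<bullet> (?x - z)"
      using N_inner_le[OF that, of y] norm_N[OF assms(1)]
      by (simp add: inner_diff_right inner_add_right norm_eq_1)
    also have "\<dots> \<le> norm (?x - z)"
      using Cauchy_Schwarz_ineq2[of "N y" "?x - z"] norm_N[OF assms(1)] by simp
    finally show ?thesis
      using assms norm_N[OF assms(1)] by (simp add: dist_norm)
  qed
  then show *: "P ?x = P y"
    using closest_point_unique[OF convex_K closed_K P_in[of y], of ?x] by simp
  then show "d ?x = r"
    using assms norm_N[OF assms(1)] by (simp add: d_eq)
  show "N ?x = N y"
    using assms norm_N[OF assms(1)] * by (simp add: outer_normal_def[of K ?x] sgn_scaleR) (simp add: sgn_div_norm)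
qed

text \<open>The left side is the signed distance of \<open>z\<close> from the supporting hyperplane
  at \<open>P x\<close>; \<open>K\<close> lies on the other side, so the nearest point of
  \<open>K\<close> is at least that far away.\<close>

lemma d_ge:
  assumes "0 < d x"
  shows "N x \<bullet> z - N x \<bullet> P x \<le> d z"
proof -
  have "N x \<bullet> z - N x \<bullet> P x \<le> N x \<bullet> (z - P z)"
    using N_inner_le[OF P_in[of z], of x] by (simp add: inner_diff_right)
  also have "\<dots> \<le> norm (z - P z)"
    using Cauchy_Schwarz_ineq2[of "N x" "z - P z"] norm_N[OF assms] by simp
  finally show ?thesis by (simp add: d_eq)
qed

text \<open>Normals are monotone: \<open>(P x - P y) \<bullet> (u - v) \<ge> 0\<close>. Hence
  \<open>(x - y) \<bullet> (u - v)\<close> is at least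
  \<open>(d x + d y) * c \<ge> 2 * t * c\<close> with \<open>c = 1 - u \<bullet> v\<close>, while
  the squared norm of \<open>u - v\<close> is \<open>2 * c\<close>. In the expanded square the mixed
  term removes at least \<open>4 * t\<^sup>2 * c\<close> and the last term adds only
  \<open>2 * t\<^sup>2 * c\<close>.\<close>

lemma nonexpansive_shift:
  assumes t: "0 \<le> t" "t < d x" "t < d y"
  shows "norm ((x - t *\<^sub>R N x) - (y - t *\<^sub>R N y)) \<le> norm (x - y)"
proof -
  define u v where "u = N x" and "v = N y"
  have u: "u \<bullet> u = 1" and v: "v \<bullet> v = 1"
    using norm_N[of x] norm_N[of y] t by (simp_all add: u_def v_def norm_eq_1)
  define c where "c = 1 - u \<bullet> v"
  have c: "0 \<le> c"
    using Cauchy_Schwarz_ineq2[of u v] u v by (simp add: c_def norm_eq_1[symmetric])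
  have uv: "(u - v) \<bullet> (u - v) = 2 * c"
    using u v by (simp add: c_def inner_diff_left inner_diff_right inner_commute)
  have xy: "(x - y) \<bullet> (u - v) = (P x - P y) \<bullet> (u - v) + (d x + d y) * c"
    by (subst decomp[of x], subst decomp[of y], fold u_def v_def)
      (use u v in \<open>simp add: c_def inner_diff_left inner_diff_right inner_add_left inner_commute algebra_simps\<close>)
  have "(P x - P y) \<bullet> (u - v) \<ge> 0"
    using N_inner_le[OF P_in[of y], of x] N_inner_le[OF P_in[of x], of y]
    by (simp add: u_def v_def inner_diff_left inner_diff_right inner_commute)
  moreover have "(2 * t) * c \<le> (d x + d y) * c"
    using t c by (intro mult_right_mono) auto
  ultimately have ge: "2 * t * c \<le> (x - y) \<bullet> (u - v)"
    using xy by linarith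
  have expand: "(norm (a - t *\<^sub>R b))\<^sup>2 = (norm a)\<^sup>2 - 2 * t * (a \<bullet> b) + t\<^sup>2 * (b \<bullet> b)" for a b :: 'a
    unfolding power2_norm_eq_inner
    by (simp add: inner_diff_left inner_diff_right inner_commute power2_eq_square)
  have "(x - t *\<^sub>R u) - (y - t *\<^sub>R v) = (x - y) - t *\<^sub>R (u - v)"
    by (simp add: algebra_simps)
  then have "(norm ((x - t *\<^sub>R u) - (y - t *\<^sub>R v)))\<^sup>2
      = (norm (x - y))\<^sup>2 - 2 * t * ((x - y) \<bullet> (u - v)) + t\<^sup>2 * ((u - v) \<bullet> (u - v))"
    using expand[of "x - y" "u - v"] by (simp only:)
  also have "\<dots> \<le> (norm (x - y))\<^sup>2 - 2 * t * (2 * t * c) + t\<^sup>2 * (2 * c)"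
    using ge t uv mult_left_mono[OF ge, of "2 * t"] by simp
  also have "\<dots> = (norm (x - y))\<^sup>2 - 2 * (t\<^sup>2 * c)"
    by (simp add: power2_eq_square)
  also have "\<dots> \<le> (norm (x - y))\<^sup>2"
    using c by simp
  finally show ?thesis
    unfolding u_def v_def by (rule power2_le_imp_le) simp
qed

lemma borel_measurable_d [measurable]: "d \<in> borel_measurable borel"
  by (intro borel_measurable_continuous_onI continuous_intros)

lemma borel_measurable_N [measurable]: "N \<in> borel_measurable borel"
proof -
  have [measurable]: "P \<in> borel_measurable borel"
    by (intro borel_measurable_continuous_onI continuous_on_closest_point convex_K closed_K nonempty_K)
  show ?thesis
    unfolding outer_normal_def sgn_div_norm by measurable
qed

lemma shell_borel: "\<omega> \<in> sets borel \<Longrightarrow> shell K a b \<omega> \<in> sets borel"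
proof -
  assume "\<omega> \<in> sets borel"
  then have "N -` \<omega> \<in> sets borel"
    using measurable_sets_borel[OF borel_measurable_N] by blast
  moreover have "{x. a < d x \<and> d x \<le> b} \<in> sets borel"
    by measurable
  moreover have "shell K a b \<omega> = {x. a < d x \<and> d x \<le> b} \<inter> N -` \<omega>"
    by (auto simp: shell_def)
  ultimately show ?thesis by simp
qed

lemma compact_parallel: "compact {x. d x \<le> b}"
proof (rule compact_eq_bounded_closed[THEN iffD2], intro conjI)
  show "closed {x. d x \<le> b}"
    by (intro closed_Collect_le continuous_intros)
  obtain B where B: "\<And>z. z \<in> K \<Longrightarrow> norm z \<le> B"
    using compact_imp_bounded[OF compact_K] by (auto simp: bounded_iff)
  show "bounded {x. d x \<le> b}"
    unfolding bounded_iff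
  proof (intro exI[of _ "B + b"] ballI)
    fix x assume "x \<in> {x. d x \<le> b}"
    then have "norm (x - P x) \<le> b" by (simp add: d_eq)
    then show "norm x \<le> B + b"
      using B[OF P_in[of x]] norm_triangle_sub[of x "P x"] by simp
  qed
qed

lemma shell_lmeasurable:
  assumes "\<omega> \<in> sets borel"
  shows "shell K a b \<omega> \<in> lmeasurable"
proof -
  have "shell K a b \<omega> \<subseteq> {x. d x \<le> b}"
    by (auto simp: shell_def)
  moreover have "{x. d x \<le> b} \<in> lmeasurable"
    by (rule lmeasurable_compact[OF compact_parallel])
  ultimately show ?thesis
    using shell_borel[OF assms, of a b] by (meson fmeasurableI2 lborelD sets_completionI_sets sets_lborel)
qed

text \<open>The nonexpansive inward shift by \<open>t\<close> maps the outer shell over the inner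
  one: a point \<open>y\<close> of the inner shell is hit by the point at distance
  \<open>d y + t\<close> on its own normal ray.\<close>

lemma measure_shell_shift:
  assumes \<omega>: "\<omega> \<in> sets borel" and a: "0 \<le> a" and t: "0 \<le> t"
  shows "measure lebesgue (shell K a b \<omega>) \<le> measure lebesgue (shell K (a + t) (b + t) \<omega>)"
proof (rule measure_nonexpansive_image_le[where f = "\<lambda>x. x - t *\<^sub>R N x"])
  show "shell K a b \<omega> \<subseteq> (\<lambda>x. x - t *\<^sub>R N x) ` shell K (a + t) (b + t) \<omega>"
  proof
    fix y assume y: "y \<in> shell K a b \<omega>"
    then have dy: "0 < d y" using a by (auto simp: shell_def)
    define x where "x = P y + (d y + t) *\<^sub>R N y"
    have x: "P x = P y" "d x = d y + t" "N x = N y"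
      using along_normal[OF dy, of "d y + t"] dy t by (simp_all add: x_def)
    have "y = x - t *\<^sub>R N x"
      using decomp[of x] decomp[of y] unfolding x by (simp add: algebra_simps)
    moreover have "x \<in> shell K (a + t) (b + t) \<omega>"
      using x y by (auto simp: shell_def)
    ultimately show "y \<in> (\<lambda>x. x - t *\<^sub>R N x) ` shell K (a + t) (b + t) \<omega>" by blast
  qed
  fix x y assume "x \<in> shell K (a + t) (b + t) \<omega>" "y \<in> shell K (a + t) (b + t) \<omega>"
  then show "norm ((x - t *\<^sub>R N x) - (y - t *\<^sub>R N y)) \<le> norm (x - y)"
    using a t by (intro nonexpansive_shift) (auto simp: shell_def)
qed (auto intro: shell_lmeasurable \<omega>)

end

section \<open>The surface area measure\<close>

text \<open>On multiples of a step \<open>h\<close> the values of \<open>m\<close> are sums of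
  nondecreasing increments, so their averages grow; this compares the ratios at \<open>k * h\<close>
  and \<open>j * h\<close>. Taking \<open>h = s / k\<close>, rounding \<open>r\<close> down to a
  multiple of \<open>h\<close> and letting \<open>k\<close> grow gives the claim; monotonicity of
  \<open>m\<close> takes the place of continuity.\<close>

lemma nondecreasing_increments_ratio_mono:
  fixes m :: "real \<Rightarrow> real"
  assumes mono: "\<And>a b. 0 \<le> a \<Longrightarrow> a \<le> b \<Longrightarrow> m a \<le> m b" and m0: "m 0 = 0"
    and incr: "\<And>a b h. 0 \<le> a \<Longrightarrow> a \<le> b \<Longrightarrow> 0 \<le> h \<Longrightarrow> m (a + h) - m a \<le> m (b + h) - m b"
    and sr: "0 < s" "s \<le> r"
  shows "m s / s \<le> m r / r"
proof -
  have grid: "real k * m (real j * h) \<ge> real j * m (real k * h)" if "0 < k" "k \<le> j" "0 < h" for j k h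
  proof -
    define e where "e i = m (real (Suc i) * h) - m (real i * h)" for i
    have e_mono: "e i \<le> e (Suc i)" for i
      using incr[of "real i * h" "real (Suc i) * h" h] that by (simp add: e_def algebra_simps)
    \<comment> \<open>\<open>m (i * h)\<close> is the sum of the first \<open>i\<close> increments,
      none of which exceeds \<open>e i\<close>.\<close>
    have le: "m (real i * h) \<le> real i * e i" for i
    proof (induction i)
      case (Suc i)
      have "m (real (Suc i) * h) \<le> real (Suc i) * e i"
        using Suc by (simp add: e_def algebra_simps)
      also have "\<dots> \<le> real (Suc i) * e (Suc i)"
        using e_mono by (intro mult_left_mono) auto
      finally show ?case .
    qed (simp add: m0)
    show ?thesis
      using that(2)
    proof (induction j rule: dec_induct)
      case (step j)
      have j: "real j > 0" using step that by simp
      have "real j * (real (Suc j) * m (real k * h)) = real (Suc j) * (real j * m (real k * h))"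
        by simp
      also have "\<dots> \<le> real (Suc j) * (real k * m (real j * h))"
        using step by (intro mult_left_mono) auto
      also have "\<dots> = real k * (real j * m (real j * h) + m (real j * h))"
        by (simp add: algebra_simps)
      also have "\<dots> \<le> real k * (real j * m (real j * h) + real j * e j)"
        using le[of j] by (intro mult_left_mono) auto
      also have "\<dots> = real j * (real k * m (real (Suc j) * h))"
        by (simp add: e_def algebra_simps)
      finally show ?case using j by simp
    qed simp
  qed
  have ms: "0 \<le> m s" using mono[of 0 s] m0 sr by simp
  have approx: "(r / s - 1 / real (Suc n)) * m s \<le> m r" for n
  proof -
    define k where "k = Suc n"
    define h where "h = s / real k"
    \<comment> \<open>\<open>j * h\<close> is the last grid point not beyond \<open>r\<close>.
      Rounding loses at most one step, which becomes the vanishing error \<open>1 / k\<close> after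
      division by \<open>k\<close>.\<close>
    define j where "j = nat \<lfloor>r / h\<rfloor>"
    have h: "h > 0" using sr by (simp add: h_def k_def)
    have "real k = s / h" using sr by (simp add: h_def k_def)
    also have "\<dots> \<le> r / h" using h sr by (simp add: divide_right_mono)
    finally have kr: "real k \<le> r / h" .
    then have kj: "k \<le> j" by (simp add: j_def le_nat_floor)
    have jr: "real j \<le> r / h" "r / h - 1 \<le> real j"
      using kr by (simp_all add: j_def k_def)
    have "(r / h - 1) * m s \<le> real j * m s"
      using jr ms by (intro mult_right_mono)
    also have "\<dots> = real j * m (real k * h)" by (simp add: h_def k_def)
    also have "\<dots> \<le> real k * m (real j * h)" using grid[OF _ kj h] by (simp add: k_def)
    also have "\<dots> \<le> real k * m r"
      using jr h by (intro mult_left_mono mono) (auto simp: field_simps)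
    finally have "(r / h - 1) * m s \<le> real k * m r" .
    then have "((r / h - 1) / real k) * m s \<le> m r"
      by (simp add: k_def field_simps)
    moreover have "(r / h - 1) / real k = r / s - 1 / real k"
      using sr by (simp add: h_def k_def field_simps)
    ultimately show ?thesis by (simp only: k_def)
  qed
  have "(\<lambda>n. (r / s - 1 / real (Suc n)) * m s) \<longlonglongrightarrow> (r / s - 0) * m s"
    by (intro tendsto_intros LIMSEQ_inverse_real_of_nat[unfolded inverse_eq_divide])
  then have "(r / s - 0) * m s \<le> m r"
    by (rule LIMSEQ_le_const2) (use approx in auto)
  then show ?thesis using sr by (simp add: field_simps)
qed

section \<open>Existence and countable additivity of the surface area measure\<close>

context convex_body
begin

definition pvol :: "'a set \<Rightarrow> real \<Rightarrow> real" where
  "pvol \<omega> b = measure lebesgue (shell K 0 b \<omega>)"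

text \<open>For Borel \<open>\<omega>\<close> the ratio is nondecreasing in \<open>\<rho>\<close>,
  so this infimum is the limit at 0 in the local Steiner formula. As an infimum it is also a lower
  bound for the ratio at every single \<open>\<rho>\<close>.\<close>

definition sarea :: "'a set \<Rightarrow> real" where
  "sarea \<omega> = (INF \<rho>\<in>{0<..}. pvol \<omega> \<rho> / \<rho>)"

abbreviation "S \<equiv> surface_area_measure K"

lemma pvol_nonneg: "0 \<le> pvol \<omega> b"
  by (simp add: pvol_def)

lemma pvol_split:
  assumes "\<omega> \<in> sets borel" "0 \<le> a" "a \<le> b"
  shows "pvol \<omega> b = pvol \<omega> a + measure lebesgue (shell K a b \<omega>)"
proof -
  have "shell K 0 b \<omega> = shell K 0 a \<omega> \<union> shell K a b \<omega>"
    using assms by (auto simp: shell_def)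
  moreover have "shell K 0 a \<omega> \<inter> shell K a b \<omega> = {}"
    by (auto simp: shell_def)
  ultimately show ?thesis
    unfolding pvol_def using shell_lmeasurable[OF assms(1)]
    by (simp add: measure_Un3)
qed

text \<open>The increments of \<open>pvol\<close> are volumes of shells, and shells of equal
  thickness grow with their distance from \<open>K\<close>.\<close>

lemma pvol_ratio_mono:
  assumes "\<omega> \<in> sets borel" "0 < a" "a \<le> b"
  shows "pvol \<omega> a / a \<le> pvol \<omega> b / b"
proof (rule nondecreasing_increments_ratio_mono)
  show "pvol \<omega> a \<le> pvol \<omega> b" if "0 \<le> a" "a \<le> b" for a b
    using pvol_split[OF assms(1) that] by simp
  have "shell K 0 0 \<omega> = {}" by (auto simp: shell_def)
  then show "pvol \<omega> 0 = 0" by (simp add: pvol_def)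
  show "pvol \<omega> (a + h) - pvol \<omega> a \<le> pvol \<omega> (b + h) - pvol \<omega> b"
    if "0 \<le> a" "a \<le> b" "0 \<le> h" for a b h
    using pvol_split[OF assms(1), of a "a + h"] pvol_split[OF assms(1), of b "b + h"]
      measure_shell_shift[OF assms(1), of a "b - a" "a + h"] that
    by (simp add: add.commute)
qed (use assms in auto)

lemma sarea_le:
  assumes "0 < \<rho>"
  shows "sarea \<omega> \<le> pvol \<omega> \<rho> / \<rho>"
  unfolding sarea_def
  by (rule cINF_lower) (use assms in \<open>auto intro!: bdd_belowI[of _ 0] simp: pvol_nonneg\<close>)

lemma sarea_nonneg: "0 \<le> sarea \<omega>"
  unfolding sarea_def by (rule cINF_greatest) (auto simp: pvol_nonneg)

lemma tendsto_sarea: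
  assumes "\<omega> \<in> sets borel"
  shows "((\<lambda>\<rho>. pvol \<omega> \<rho> / \<rho>) \<longlongrightarrow> sarea \<omega>) (at_right 0)"
proof (rule order_tendstoI)
  fix a assume "a < sarea \<omega>"
  then show "\<forall>\<^sub>F \<rho> in at_right 0. a < pvol \<omega> \<rho> / \<rho>"
    by (intro eventually_at_rightI[of 0 1] less_le_trans[OF _ sarea_le]) auto
next
  fix a assume "sarea \<omega> < a"
  then obtain b where b: "0 < b" "pvol \<omega> b / b < a"
    unfolding sarea_def by (meson cINF_greatest greaterThan_iff greaterThan_non_empty not_less)
  then show "\<forall>\<^sub>F \<rho> in at_right 0. pvol \<omega> \<rho> / \<rho> < a"
    by (intro eventually_at_rightI[of 0 b] le_less_trans[OF pvol_ratio_mono[OF assms] b(2)]) auto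
qed

lemma Lim_parallel_volume:
  assumes "\<omega> \<in> sets borel"
  shows "Lim (at_right 0) (\<lambda>\<rho>. emeasure lebesgue (local_parallel_set K \<rho> \<omega>) / ennreal \<rho>) = ennreal (sarea \<omega>)"
proof (rule tendsto_Lim)
  have "((\<lambda>\<rho>. ennreal (pvol \<omega> \<rho> / \<rho>)) \<longlongrightarrow> ennreal (sarea \<omega>)) (at_right 0)"
    by (intro tendsto_intros tendsto_sarea assms)
  moreover have "\<forall>\<^sub>F \<rho> in at_right 0. ennreal (pvol \<omega> \<rho> / \<rho>)
      = emeasure lebesgue (local_parallel_set K \<rho> \<omega>) / ennreal \<rho>"
    using shell_lmeasurable[OF assms, of 0]
    by (intro eventually_at_rightI[of 0 1])
      (simp_all add: local_parallel_set_eq_shell pvol_def emeasure_eq_measure2 divide_ennreal)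
  ultimately show "((\<lambda>\<rho>. emeasure lebesgue (local_parallel_set K \<rho> \<omega>) / ennreal \<rho>) \<longlongrightarrow> ennreal (sarea \<omega>)) (at_right 0)"
    by (rule Lim_transform_eventually)
qed simp

lemma sarea_Un:
  assumes "\<omega> \<in> sets borel" "\<omega>' \<in> sets borel" "\<omega> \<inter> \<omega>' = {}"
  shows "sarea (\<omega> \<union> \<omega>') = sarea \<omega> + sarea \<omega>'"
proof -
  have eq: "pvol (\<omega> \<union> \<omega>') \<rho> = pvol \<omega> \<rho> + pvol \<omega>' \<rho>" for \<rho>
  proof -
    have "shell K 0 \<rho> (\<omega> \<union> \<omega>') = shell K 0 \<rho> \<omega> \<union> shell K 0 \<rho> \<omega>'"
      "shell K 0 \<rho> \<omega> \<inter> shell K 0 \<rho> \<omega>' = {}"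
      using assms(3) by (auto simp: shell_def)
    then show ?thesis
      unfolding pvol_def using shell_lmeasurable[of _ 0 \<rho>] assms
      by (simp add: measure_Un3)
  qed
  have "((\<lambda>\<rho>. pvol \<omega> \<rho> / \<rho> + pvol \<omega>' \<rho> / \<rho>) \<longlongrightarrow> sarea \<omega> + sarea \<omega>') (at_right 0)"
    by (intro tendsto_intros tendsto_sarea assms)
  moreover have "((\<lambda>\<rho>. pvol \<omega> \<rho> / \<rho> + pvol \<omega>' \<rho> / \<rho>) \<longlongrightarrow> sarea (\<omega> \<union> \<omega>')) (at_right 0)"
    using tendsto_sarea[of "\<omega> \<union> \<omega>'"] assms by (simp add: eq add_divide_distrib)
  ultimately show ?thesis
    by (rule tendsto_unique[OF trivial_limit_at_right_real, symmetric])
qed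

text \<open>\<open>sarea\<close> is dominated by the shell volume at \<open>\<rho> = 1\<close>,
  where continuity from above is that of Lebesgue measure; this avoids interchanging two
  limits.\<close>

lemma sarea_decseq:
  assumes A: "range A \<subseteq> sets borel" "decseq A" "(\<Inter>i. A i) = {}"
  shows "(\<lambda>i. sarea (A i)) \<longlonglongrightarrow> 0"
proof -
  have "(\<lambda>i. measure lebesgue (shell K 0 1 (A i))) \<longlonglongrightarrow> measure lebesgue (\<Inter>i. shell K 0 1 (A i))"
  proof (rule Lim_measure_decseq)
    show "range (\<lambda>i. shell K 0 1 (A i)) \<subseteq> sets lebesgue"
      using shell_lmeasurable A by (blast intro: fmeasurableD)
    show "decseq (\<lambda>i. shell K 0 1 (A i))"
      using A(2) by (auto simp: decseq_def shell_def)
    show "emeasure lebesgue (shell K 0 1 (A i)) \<noteq> \<infinity>" for i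
      using shell_lmeasurable[of "A i" 0 1] A(1) by (metis fmeasurableD2 infinity_ennreal_def range_subsetD)
  qed
  moreover have "(\<Inter>i. shell K 0 1 (A i)) = {}"
    using A(3) by (auto simp: shell_def)
  ultimately have lim: "(\<lambda>i. pvol (A i) 1) \<longlonglongrightarrow> 0"
    by (simp add: pvol_def)
  show ?thesis
    by (rule tendsto_sandwich[OF _ _ tendsto_const lim])
      (use sarea_nonneg sarea_le[of 1] in auto)
qed

lemma space_S: "space S = sphere 0 1"
  and sets_S: "sets S = sets (restrict_space borel (sphere 0 1))"
proof -
  have "sets (restrict_space borel (sphere (0::'a) 1)) \<subseteq> Pow (sphere 0 1)"
    using sets.sets_into_space[of _ "restrict_space borel (sphere (0::'a) 1)"] by (auto simp: space_restrict_space)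
  moreover have "sigma_sets (sphere 0 1) (sets (restrict_space borel (sphere (0::'a) 1))) = sets (restrict_space borel (sphere 0 1))"
    using sets.sigma_sets_eq[of "restrict_space borel (sphere (0::'a) 1)"] by (simp add: space_restrict_space)
  ultimately show "space S = sphere 0 1" "sets S = sets (restrict_space borel (sphere 0 1))"
    by (auto simp: surface_area_measure_def space_measure_of_conv sets_measure_of)
qed

lemma in_sets_S_iff: "\<omega> \<in> sets S \<longleftrightarrow> \<omega> \<subseteq> sphere 0 1 \<and> \<omega> \<in> sets borel"
  unfolding sets_S by (subst sets_restrict_space_iff) auto

text \<open>\<open>measure_of\<close> returns the given set function only if that is a measure. A
  finite additive set function is countably additive as soon as it is continuous at the empty set,
  which \<open>sarea_decseq\<close> provides.\<close>

lemma emeasure_S: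
  assumes "\<omega> \<in> sets S"
  shows "emeasure S \<omega> = ennreal (sarea \<omega>)"
proof -
  define f where "f = (\<lambda>\<omega>. Lim (at_right 0) (\<lambda>\<rho>. emeasure lebesgue (local_parallel_set K \<rho> \<omega>) / ennreal \<rho>))"
  have f: "f \<omega> = ennreal (sarea \<omega>)" if "\<omega> \<in> sets S" for \<omega>
    using that Lim_parallel_volume by (simp add: f_def in_sets_S_iff)
  \<comment> \<open>Additivity with both sets empty reads
    \<open>sarea {} = 2 * sarea {}\<close>.\<close>
  have "sarea {} = 0"
    using sarea_Un[of "{}" "{}"] by simp
  then have pos: "positive (sets S) f"
    by (simp add: positive_def f)
  have "countably_additive (sets S) f"
  proof (rule sets.empty_continuous_imp_countably_additive[OF pos])
    show "additive (sets S) f"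
      unfolding additive_def by (auto simp: f sarea_Un in_sets_S_iff sarea_nonneg)
    show "\<forall>A\<in>sets S. f A \<noteq> \<infinity>"
      by (simp add: f)
    fix A :: "nat \<Rightarrow> 'a set" assume A: "range A \<subseteq> sets S" "decseq A" "(\<Inter>i. A i) = {}"
    have "f (A i) = ennreal (sarea (A i))" for i
      using f A(1) by blast
    moreover have "(\<lambda>i. ennreal (sarea (A i))) \<longlonglongrightarrow> ennreal 0"
      using A by (intro tendsto_intros sarea_decseq) (auto simp: in_sets_S_iff)
    ultimately show "(\<lambda>i. f (A i)) \<longlonglongrightarrow> 0" by simp
  qed
  moreover have "S = measure_of (sphere 0 1) (sets S) f"
    unfolding sets_S by (simp add: surface_area_measure_def f_def)
  moreover have "sets S \<subseteq> Pow (sphere 0 1)"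
    using sets.sets_into_space[of _ S] by (auto simp: space_S)
  ultimately have "emeasure S \<omega> = f \<omega>"
    using emeasure_measure_of[of S "sphere 0 1" "sets S" f \<omega>] pos assms by blast
  then show ?thesis
    using f[OF assms] by simp
qed

lemma measure_S: "\<omega> \<in> sets S \<Longrightarrow> measure S \<omega> = sarea \<omega>"
  by (simp add: measure_def emeasure_S sarea_nonneg)

lemma finite_measure_S: "finite_measure S"
  by (rule finite_measureI) (simp add: emeasure_S)

end

section \<open>The Brunn-Minkowski inequality\<close>

definition minkowski_sum :: "'a::plus set \<Rightarrow> 'a set \<Rightarrow> 'a set" where
  "minkowski_sum A B = {x + y |x y. x \<in> A \<and> y \<in> B}"

definition hbox :: "'a::euclidean_space \<Rightarrow> 'a \<Rightarrow> 'a set" where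
  "hbox a b = {x. \<forall>i\<in>Basis. a \<bullet> i \<le> x \<bullet> i \<and> x \<bullet> i < b \<bullet> i}"

lemma hbox_borel: "hbox a b \<in> sets borel"
  unfolding hbox_def by measurable

lemma hbox_subset_cbox: "hbox a b \<subseteq> cbox a b"
  and box_subset_hbox: "box a b \<subseteq> hbox a b"
  unfolding hbox_def cbox_def box_def by (blast intro: less_imp_le)+

lemma hbox_lmeasurable: "hbox a b \<in> lmeasurable"
proof (rule fmeasurableI2[OF lmeasurable_cbox hbox_subset_cbox])
  show "hbox a b \<in> sets lebesgue"
    using hbox_borel[of a b] sets_completionI_sets[of "hbox a b" lborel] by simp
qed

lemma measure_hbox:
  assumes "\<And>i. i \<in> Basis \<Longrightarrow> a \<bullet> i \<le> b \<bullet> i"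
  shows "measure lebesgue (hbox a b) = (\<Prod>i\<in>Basis. (b - a) \<bullet> i)"
proof (rule antisym)
  have "measure lebesgue (hbox a b) \<le> measure lebesgue (cbox a b)"
    by (intro measure_mono_fmeasurable hbox_subset_cbox fmeasurableD hbox_lmeasurable lmeasurable_cbox)
  then show "measure lebesgue (hbox a b) \<le> (\<Prod>i\<in>Basis. (b - a) \<bullet> i)"
    using assms by (simp add: content_cbox' box_ne_empty)
  have "measure lebesgue (box a b) \<le> measure lebesgue (hbox a b)"
    by (intro measure_mono_fmeasurable box_subset_hbox fmeasurableD hbox_lmeasurable lmeasurable_box)
  then show "(\<Prod>i\<in>Basis. (b - a) \<bullet> i) \<le> measure lebesgue (hbox a b)"
    using assms by (simp add: measure_lborel_box_eq)
qed

text \<open>A pair stands for the half-open box it spans; half-openness lets a coordinate hyperplane cut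
  a family of disjoint boxes into two such families without overlap.\<close>

definition hbox_family :: "('a::euclidean_space \<times> 'a) set \<Rightarrow> bool" where
  "hbox_family F \<longleftrightarrow> finite F \<and> F \<noteq> {} \<and> (\<forall>p\<in>F. \<forall>i\<in>Basis. fst p \<bullet> i < snd p \<bullet> i) \<and>
     disjoint_family_on (\<lambda>p. hbox (fst p) (snd p)) F"

definition hboxes :: "('a::euclidean_space \<times> 'a) set \<Rightarrow> 'a set" where
  "hboxes F = (\<Union>p\<in>F. hbox (fst p) (snd p))"

lemma hboxes_lmeasurable: "finite F \<Longrightarrow> hboxes F \<in> lmeasurable"
  unfolding hboxes_def by (rule fmeasurable.finite_UN) (auto simp: hbox_lmeasurable)

lemma measure_hboxes:
  assumes "hbox_family F"
  shows "measure lebesgue (hboxes F) = (\<Sum>p\<in>F. \<Prod>i\<in>Basis. (snd p - fst p) \<bullet> i)"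
proof -
  have "measure lebesgue (hboxes F) = (\<Sum>x\<in>F. measure lebesgue (hbox (fst x) (snd x)))"
    unfolding hboxes_def
    by (rule measure_finite_Union)
      (use assms in \<open>auto simp: hbox_family_def fmeasurableD fmeasurableD2[OF hbox_lmeasurable, simplified]
        hbox_lmeasurable simp del: emeasure_completion\<close>)
  also have "\<dots> = (\<Sum>p\<in>F. \<Prod>i\<in>Basis. (snd p - fst p) \<bullet> i)"
    using assms by (intro sum.cong) (auto simp: hbox_family_def measure_hbox less_imp_le)
  finally show ?thesis .
qed

lemma measure_hboxes_pos:
  assumes "hbox_family F"
  shows "0 < measure lebesgue (hboxes F)"
  unfolding measure_hboxes[OF assms]
  by (rule sum_pos) (use assms in \<open>auto simp: hbox_family_def inner_diff_left intro!: prod_pos\<close>)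

lemma minkowski_sum_hbox:
  assumes "\<And>i. i \<in> Basis \<Longrightarrow> a \<bullet> i < b \<bullet> i" "\<And>i. i \<in> Basis \<Longrightarrow> c \<bullet> i < d \<bullet> i"
  shows "minkowski_sum (hbox a b) (hbox c d) = hbox (a + c) (b + d)"
proof (intro equalityI subsetI)
  fix z assume "z \<in> minkowski_sum (hbox a b) (hbox c d)"
  then show "z \<in> hbox (a + c) (b + d)"
    by (force simp: minkowski_sum_def hbox_def inner_add_left intro: add_mono add_strict_mono)
next
  fix z assume z: "z \<in> hbox (a + c) (b + d)"
  \<comment> \<open>\<open>t i\<close> is the relative position of \<open>z\<close> in the
    \<open>i\<close>-th side of the sum box. Both summands take this same relative position in their
    own boxes; \<open>t i < 1\<close> keeps them off the open ends.\<close>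
  define t where "t i = (z \<bullet> i - (a + c) \<bullet> i) / ((b + d) \<bullet> i - (a + c) \<bullet> i)" for i
  define x y where "x = (\<Sum>i\<in>Basis. (a \<bullet> i + t i * (b \<bullet> i - a \<bullet> i)) *\<^sub>R i)"
    and "y = (\<Sum>i\<in>Basis. (c \<bullet> i + t i * (d \<bullet> i - c \<bullet> i)) *\<^sub>R i)"
  have t: "0 \<le> t i \<and> t i < 1" if "i \<in> Basis" for i
    using z assms[OF that] that by (auto simp: t_def hbox_def inner_add_left divide_simps)
  have conv: "l \<le> l + r * (u - l) \<and> l + r * (u - l) < u" if "l < u" "0 \<le> r" "r < 1" for l u r :: real
  proof
    show "l \<le> l + r * (u - l)" using that by simp
    have "l + r * (u - l) < l + 1 * (u - l)"
      using that by (intro add_strict_left_mono mult_strict_right_mono) auto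
    then show "l + r * (u - l) < u" by simp
  qed
  have "x \<in> hbox a b" "y \<in> hbox c d"
    using conv[OF assms(1)] conv[OF assms(2)] t by (simp_all add: x_def y_def hbox_def)
  moreover have "z = x + y"
  proof (rule euclidean_eqI)
    fix i :: 'a assume i: "i \<in> Basis"
    have "t i * ((b + d) \<bullet> i - (a + c) \<bullet> i) = z \<bullet> i - (a + c) \<bullet> i"
      using assms[OF i] by (simp add: t_def inner_add_left)
    then show "z \<bullet> i = (x + y) \<bullet> i"
      using i by (simp add: x_def y_def inner_add_left) (simp add: algebra_simps)
  qed
  ultimately show "z \<in> minkowski_sum (hbox a b) (hbox c d)"
    by (auto simp: minkowski_sum_def)
qed

lemma minkowski_sum_hboxes_lmeasurable:
  assumes "hbox_family F" "hbox_family G"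
  shows "minkowski_sum (hboxes F) (hboxes G) \<in> lmeasurable"
proof -
  have "minkowski_sum (hboxes F) (hboxes G) = (\<Union>p\<in>F. \<Union>q\<in>G. minkowski_sum (hbox (fst p) (snd p)) (hbox (fst q) (snd q)))"
    unfolding minkowski_sum_def hboxes_def by blast
  also have "\<dots> = (\<Union>p\<in>F. \<Union>q\<in>G. hbox (fst p + fst q) (snd p + snd q))"
    using assms by (intro SUP_cong refl minkowski_sum_hbox) (auto simp: hbox_family_def)
  also have "\<dots> \<in> lmeasurable"
    using assms by (intro fmeasurable.finite_UN) (auto simp: hbox_family_def hbox_lmeasurable)
  finally show ?thesis .
qed

text \<open>After division by the right side, apply the inequality of arithmetic and geometric means
  to the ratios \<open>p i / (p i + q i)\<close> and \<open>q i / (p i + q i)\<close>, which add up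
  to 1 for each \<open>i\<close>. With side lengths \<open>p\<close> and \<open>q\<close> this is
  the Brunn-Minkowski inequality for two boxes.\<close>

lemma root_prod_add_le:
  fixes p q :: "'i \<Rightarrow> real"
  assumes "finite I" "I \<noteq> {}" "\<And>i. i \<in> I \<Longrightarrow> 0 < p i" "\<And>i. i \<in> I \<Longrightarrow> 0 < q i"
  shows "root (card I) (\<Prod>i\<in>I. p i) + root (card I) (\<Prod>i\<in>I. q i) \<le> root (card I) (\<Prod>i\<in>I. p i + q i)"
proof -
  define n where "n = card I"
  have n: "0 < n" using assms by (simp add: n_def card_gt_0_iff)
  define Q where "Q = root n (\<Prod>i\<in>I. p i + q i)"
  have s: "0 < p i + q i" if "i \<in> I" for i using assms(3,4)[OF that] by simp
  have Q: "Q > 0" unfolding Q_def using n s by (simp add: prod_pos)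
  have amgm: "root n (\<Prod>i\<in>I. r i) / Q \<le> (\<Sum>i\<in>I. r i / (p i + q i)) / n"
    if r: "\<And>i. i \<in> I \<Longrightarrow> 0 < r i" for r
  proof -
    have "root n (\<Prod>i\<in>I. r i) / Q = root n (\<Prod>i\<in>I. r i / (p i + q i))"
      by (simp add: Q_def real_root_divide prod_dividef)
    also have "\<dots> = (\<Prod>i\<in>I. r i / (p i + q i)) powr (1 / n)"
    proof -
      have "0 < (\<Prod>i\<in>I. r i / (p i + q i))"
        using r s by (intro prod_pos divide_pos_pos)
      then show ?thesis
        using n by (simp add: root_powr_inverse inverse_eq_divide)
    qed
    also have "\<dots> \<le> (\<Sum>i\<in>I. r i / (p i + q i) / n)"
      unfolding n_def using assms r s by (intro arith_geom_mean) (auto intro: less_imp_le)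
    finally show ?thesis by (simp add: sum_divide_distrib)
  qed
  have "(\<Sum>i\<in>I. p i / (p i + q i)) + (\<Sum>i\<in>I. q i / (p i + q i)) = (\<Sum>i\<in>I. 1)"
    unfolding sum.distrib[symmetric]
  proof (rule sum.cong)
    fix i assume "i \<in> I"
    then show "p i / (p i + q i) + q i / (p i + q i) = 1"
      using s[of i] by (simp add: add_divide_distrib[symmetric])
  qed simp
  then have "(\<Sum>i\<in>I. p i / (p i + q i)) / n + (\<Sum>i\<in>I. q i / (p i + q i)) / n = 1"
    using n by (simp add: add_divide_distrib[symmetric] n_def)
  then have "root n (\<Prod>i\<in>I. p i) / Q + root n (\<Prod>i\<in>I. q i) / Q \<le> 1"
    using amgm[of p, OF assms(3)] amgm[of q, OF assms(4)] by linarith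
  then show ?thesis
    using Q by (simp add: add_divide_distrib[symmetric] Q_def n_def)
qed

section \<open>Cutting families of boxes by coordinate hyperplanes\<close>

definition cut_below :: "'a::euclidean_space \<Rightarrow> real \<Rightarrow> ('a \<times> 'a) set \<Rightarrow> ('a \<times> 'a) set" where
  "cut_below i c F = (\<lambda>p. (fst p, snd p + (min (snd p \<bullet> i) c - snd p \<bullet> i) *\<^sub>R i)) ` {p \<in> F. fst p \<bullet> i < c}"

definition cut_above :: "'a::euclidean_space \<Rightarrow> real \<Rightarrow> ('a \<times> 'a) set \<Rightarrow> ('a \<times> 'a) set" where
  "cut_above i c F = (\<lambda>p. (fst p + (max (fst p \<bullet> i) c - fst p \<bullet> i) *\<^sub>R i, snd p)) ` {p \<in> F. c < snd p \<bullet> i}"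

lemma inner_add_scaleR_Basis:
  "i \<in> Basis \<Longrightarrow> j \<in> Basis \<Longrightarrow> (b + t *\<^sub>R i) \<bullet> j = (if j = i then b \<bullet> i + t else b \<bullet> j)"
  by (auto simp: inner_add_left inner_Basis)

lemma hbox_cut_below:
  "i \<in> Basis \<Longrightarrow> hbox a (b + (min (b \<bullet> i) c - b \<bullet> i) *\<^sub>R i) = hbox a b \<inter> {x. x \<bullet> i < c}"
  by (auto simp: hbox_def inner_add_scaleR_Basis split: if_splits)

lemma hbox_cut_above:
  "i \<in> Basis \<Longrightarrow> hbox (a + (max (a \<bullet> i) c - a \<bullet> i) *\<^sub>R i) b = hbox a b \<inter> {x. c \<le> x \<bullet> i}"
  by (auto simp: hbox_def inner_add_scaleR_Basis split: if_splits)

lemma hboxes_cut_below: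
  assumes "i \<in> Basis"
  shows "hboxes (cut_below i c F) = hboxes F \<inter> {x. x \<bullet> i < c}"
proof -
  have "hboxes (cut_below i c F) = (\<Union>p\<in>{p \<in> F. fst p \<bullet> i < c}. hbox (fst p) (snd p) \<inter> {x. x \<bullet> i < c})"
    using assms unfolding hboxes_def cut_below_def by (simp add: hbox_cut_below)
  also have "\<dots> = hboxes F \<inter> {x. x \<bullet> i < c}"
  proof -
    have "fst p \<bullet> i < c" if "x \<in> hbox (fst p) (snd p)" "x \<bullet> i < c" for p x
      using that assms le_less_trans unfolding hbox_def by blast
    then show ?thesis
      unfolding hboxes_def by blast
  qed
  finally show ?thesis .
qed

lemma hboxes_cut_above:
  assumes "i \<in> Basis"
  shows "hboxes (cut_above i c F) = hboxes F \<inter> {x. c \<le> x \<bullet> i}"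
proof -
  have "hboxes (cut_above i c F) = (\<Union>p\<in>{p \<in> F. c < snd p \<bullet> i}. hbox (fst p) (snd p) \<inter> {x. c \<le> x \<bullet> i})"
    using assms unfolding hboxes_def cut_above_def by (simp add: hbox_cut_above)
  also have "\<dots> = hboxes F \<inter> {x. c \<le> x \<bullet> i}"
  proof -
    have "c < snd p \<bullet> i" if "x \<in> hbox (fst p) (snd p)" "c \<le> x \<bullet> i" for p x
      using that assms le_less_trans unfolding hbox_def by blast
    then show ?thesis
      unfolding hboxes_def by blast
  qed
  finally show ?thesis .
qed

text \<open>Each cut passes to a subfamily and shrinks its boxes one by one to nonempty boxes, so
  disjointness is inherited.\<close>

lemma hbox_family_image:
  assumes F: "hbox_family F" and "F' \<subseteq> F" "F' \<noteq> {}"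
    and h: "\<And>p i. p \<in> F' \<Longrightarrow> i \<in> Basis \<Longrightarrow> fst (h p) \<bullet> i < snd (h p) \<bullet> i"
    and sub: "\<And>p. p \<in> F' \<Longrightarrow> hbox (fst (h p)) (snd (h p)) \<subseteq> hbox (fst p) (snd p)"
  shows "hbox_family (h ` F')"
  unfolding hbox_family_def
proof (intro conjI)
  show "finite (h ` F')" using assms(1,2) finite_subset unfolding hbox_family_def by blast
  show "\<forall>p\<in>h ` F'. \<forall>i\<in>Basis. fst p \<bullet> i < snd p \<bullet> i"
    using h by blast
  have "hbox (fst p) (snd p) \<inter> hbox (fst q) (snd q) = {}" if "p \<in> F'" "q \<in> F'" "p \<noteq> q" for p q
    using that assms(1,2) unfolding hbox_family_def disjoint_family_on_def by blast
  then have "hbox (fst (h p)) (snd (h p)) \<inter> hbox (fst (h q)) (snd (h q)) = {}"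
    if "p \<in> F'" "q \<in> F'" "p \<noteq> q" for p q
    using that sub[of p] sub[of q] by blast
  then show "disjoint_family_on (\<lambda>p. hbox (fst p) (snd p)) (h ` F')"
    unfolding disjoint_family_on_def by blast
qed (use assms(3) in blast)

lemma hbox_family_cut_below:
  assumes "hbox_family F" "i \<in> Basis" "p \<in> F" "fst p \<bullet> i < c"
  shows "hbox_family (cut_below i c F)" "card (cut_below i c F) \<le> card F"
proof -
  show "hbox_family (cut_below i c F)"
    unfolding cut_below_def
  proof (rule hbox_family_image[OF assms(1)])
    show "{p \<in> F. fst p \<bullet> i < c} \<noteq> {}" using assms(3,4) by blast
  qed (use assms(1,2) in \<open>auto simp: hbox_cut_below inner_add_scaleR_Basis hbox_family_def\<close>)
  have "card (cut_below i c F) \<le> card {p \<in> F. fst p \<bullet> i < c}"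
    unfolding cut_below_def using assms(1)
    by (intro card_image_le) (simp add: hbox_family_def)
  also have "\<dots> \<le> card F"
    using assms(1) by (intro card_mono) (auto simp: hbox_family_def)
  finally show "card (cut_below i c F) \<le> card F" .
qed

lemma hbox_family_cut_above:
  assumes "hbox_family F" "i \<in> Basis" "p \<in> F" "c < snd p \<bullet> i"
  shows "hbox_family (cut_above i c F)" "card (cut_above i c F) \<le> card F"
proof -
  show "hbox_family (cut_above i c F)"
    unfolding cut_above_def
  proof (rule hbox_family_image[OF assms(1)])
    show "{p \<in> F. c < snd p \<bullet> i} \<noteq> {}" using assms(3,4) by blast
  qed (use assms(1,2) in \<open>auto simp: hbox_cut_above inner_add_scaleR_Basis hbox_family_def\<close>)
  have "card (cut_above i c F) \<le> card {p \<in> F. c < snd p \<bullet> i}"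
    unfolding cut_above_def using assms(1)
    by (intro card_image_le) (simp add: hbox_family_def)
  also have "\<dots> \<le> card F"
    using assms(1) by (intro card_mono) (auto simp: hbox_family_def)
  finally show "card (cut_above i c F) \<le> card F" .
qed

text \<open>A box lying wholly on the other side is discarded by the cut. This strict decrease
  drives the induction on the number of boxes.\<close>

lemma card_cut_below_less:
  assumes "finite F" "p \<in> F" "c \<le> fst p \<bullet> i"
  shows "card (cut_below i c F) < card F"
proof -
  have "card (cut_below i c F) \<le> card {p \<in> F. fst p \<bullet> i < c}"
    unfolding cut_below_def using assms(1)
    by (intro card_image_le) simp
  also have "\<dots> < card F"
  proof (rule psubset_card_mono[OF assms(1)])
    show "{p \<in> F. fst p \<bullet> i < c} \<subset> F"
      using assms(2,3) not_le by blast
  qed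
  finally show ?thesis .
qed

lemma card_cut_above_less:
  assumes "finite F" "p \<in> F" "snd p \<bullet> i \<le> c"
  shows "card (cut_above i c F) < card F"
proof -
  have "card (cut_above i c F) \<le> card {p \<in> F. c < snd p \<bullet> i}"
    unfolding cut_above_def using assms(1)
    by (intro card_image_le) simp
  also have "\<dots> < card F"
  proof (rule psubset_card_mono[OF assms(1)])
    show "{p \<in> F. c < snd p \<bullet> i} \<subset> F"
      using assms(2,3) not_le by blast
  qed
  finally show ?thesis .
qed

text \<open>If the sides overlapped in every coordinate, the point with coordinates
  \<open>max (a \<bullet> i) (c \<bullet> i)\<close> would lie in both boxes.\<close>

lemma hbox_separated:
  assumes "\<And>i. i \<in> Basis \<Longrightarrow> a \<bullet> i < b \<bullet> i" "\<And>i. i \<in> Basis \<Longrightarrow> c \<bullet> i < d \<bullet> i"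
    and "hbox a b \<inter> hbox c d = {}"
  obtains i where "i \<in> Basis" "b \<bullet> i \<le> c \<bullet> i \<or> d \<bullet> i \<le> a \<bullet> i"
proof -
  define x where "x = (\<Sum>i\<in>Basis. max (a \<bullet> i) (c \<bullet> i) *\<^sub>R i)"
  have "x \<in> hbox a b \<inter> hbox c d" if "\<forall>i\<in>Basis. c \<bullet> i < b \<bullet> i \<and> a \<bullet> i < d \<bullet> i"
    using that assms(1,2) by (simp add: hbox_def x_def)
  then have "\<not> (\<forall>i\<in>Basis. c \<bullet> i < b \<bullet> i \<and> a \<bullet> i < d \<bullet> i)"
    using assms(3) by blast
  then obtain i where "i \<in> Basis" "\<not> (c \<bullet> i < b \<bullet> i \<and> a \<bullet> i < d \<bullet> i)" by blast
  then show ?thesis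
    using that[of i] by (simp add: not_less)
qed

lemma measure_hboxes_halfspace_Un:
  assumes "finite F" "i \<in> Basis"
  shows "measure lebesgue (hboxes F) = measure lebesgue (hboxes (cut_below i c F)) + measure lebesgue (hboxes (cut_above i c F))"
proof -
  have fin: "finite (cut_below i c F)" "finite (cut_above i c F)"
    unfolding cut_below_def cut_above_def using assms(1) by simp_all
  have "hboxes F = hboxes (cut_below i c F) \<union> hboxes (cut_above i c F)"
    "hboxes (cut_below i c F) \<inter> hboxes (cut_above i c F) = {}"
    using assms(2) by (auto simp: hboxes_cut_below hboxes_cut_above)
  then show ?thesis
    using fin by (simp add: measure_Un3 hboxes_lmeasurable)
qed

text \<open>The truncation by \<open>max\<close> and \<open>min\<close> covers every position of the
  hyperplane by one formula that is visibly continuous in \<open>d\<close>.\<close>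

lemma measure_hbox_cut_below:
  assumes "i \<in> Basis" "\<And>j. j \<in> Basis \<Longrightarrow> a \<bullet> j < b \<bullet> j"
  shows "measure lebesgue (hbox a b \<inter> {x. x \<bullet> i < d}) =
    max 0 (min (b \<bullet> i) d - a \<bullet> i) * (\<Prod>j\<in>Basis - {i}. (b - a) \<bullet> j)"
proof (cases "a \<bullet> i < d")
  case True
  define b' where "b' = b + (min (b \<bullet> i) d - b \<bullet> i) *\<^sub>R i"
  have b': "b' \<bullet> j = (if j = i then min (b \<bullet> i) d else b \<bullet> j)" if "j \<in> Basis" for j
    using inner_add_scaleR_Basis[OF assms(1) that] by (simp add: b'_def)
  have "measure lebesgue (hbox a b \<inter> {x. x \<bullet> i < d}) = measure lebesgue (hbox a b')"
    by (simp add: b'_def hbox_cut_below[OF assms(1)])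
  also have "\<dots> = (\<Prod>j\<in>Basis. (b' - a) \<bullet> j)"
    using True assms b' by (intro measure_hbox) (auto intro: less_imp_le)
  also have "\<dots> = (b' - a) \<bullet> i * (\<Prod>j\<in>Basis - {i}. (b' - a) \<bullet> j)"
    using assms(1) by (simp add: prod.remove)
  also have "(\<Prod>j\<in>Basis - {i}. (b' - a) \<bullet> j) = (\<Prod>j\<in>Basis - {i}. (b - a) \<bullet> j)"
    by (rule prod.cong) (simp_all add: b' inner_diff_left)
  also have "(b' - a) \<bullet> i = max 0 (min (b \<bullet> i) d - a \<bullet> i)"
    using True assms by (simp add: inner_diff_left b')
  finally show ?thesis .
next
  case False
  then have "hbox a b \<inter> {x. x \<bullet> i < d} = {}"
    using assms(1) unfolding hbox_def by (auto dest: le_less_trans)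
  then show ?thesis using False by simp
qed

text \<open>The volume below height \<open>d\<close> is a finite sum of truncated box volumes, hence
  continuous in \<open>d\<close>. It runs from 0 at the lowest end of a box to the full volume at
  the highest, so every fraction is attained.\<close>

lemma hboxes_cut_fraction:
  assumes G: "hbox_family G" and i: "i \<in> Basis" and \<theta>: "0 < \<theta>" "\<theta> < 1"
  obtains d where "measure lebesgue (hboxes G \<inter> {x. x \<bullet> i < d}) = \<theta> * measure lebesgue (hboxes G)"
proof -
  define g where "g d = (\<Sum>p\<in>G. max 0 (min (snd p \<bullet> i) d - fst p \<bullet> i) * (\<Prod>j\<in>Basis - {i}. (snd p - fst p) \<bullet> j))" for d
  have finG: "finite G" and posG: "\<And>p j. p \<in> G \<Longrightarrow> j \<in> Basis \<Longrightarrow> fst p \<bullet> j < snd p \<bullet> j"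
    and disG: "disjoint_family_on (\<lambda>p. hbox (fst p) (snd p)) G"
    using G by (simp_all add: hbox_family_def)
  have half: "{x::'a. x \<bullet> i < d} \<in> sets lebesgue" for d
    by (intro sets_completionI_sets) simp
  have g_eq: "measure lebesgue (hboxes G \<inter> {x. x \<bullet> i < d}) = g d" for d
  proof -
    have "hboxes G \<inter> {x. x \<bullet> i < d} = (\<Union>p\<in>G. hbox (fst p) (snd p) \<inter> {x. x \<bullet> i < d})"
      by (auto simp: hboxes_def)
    also have "measure lebesgue \<dots> = (\<Sum>p\<in>G. measure lebesgue (hbox (fst p) (snd p) \<inter> {x. x \<bullet> i < d}))"
    proof (rule measure_finite_Union[OF finG])
      have fm: "hbox (fst p) (snd p) \<inter> {x. x \<bullet> i < d} \<in> lmeasurable" for p :: "'a \<times> 'a"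
        by (intro fmeasurable_Int_fmeasurable hbox_lmeasurable half)
      then show "(\<lambda>p. hbox (fst p) (snd p) \<inter> {x. x \<bullet> i < d}) ` G \<subseteq> sets lebesgue"
        by (blast intro: fmeasurableD)
      show "emeasure lebesgue (hbox (fst p) (snd p) \<inter> {x. x \<bullet> i < d}) \<noteq> \<infinity>" for p :: "'a \<times> 'a"
        using fmeasurableD2[OF fm] by simp
      show "disjoint_family_on (\<lambda>p. hbox (fst p) (snd p) \<inter> {x. x \<bullet> i < d}) G"
        using disG unfolding disjoint_family_on_def by blast
    qed
    also have "\<dots> = g d"
      unfolding g_def using posG i by (intro sum.cong refl measure_hbox_cut_below) auto
    finally show ?thesis .
  qed
  define l where "l = Min ((\<lambda>p. fst p \<bullet> i) ` G)"
  define u where "u = Max ((\<lambda>p. snd p \<bullet> i) ` G)"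
  have l: "l \<le> fst p \<bullet> i" and u: "snd p \<bullet> i \<le> u" if "p \<in> G" for p
    using finG that by (simp_all add: l_def u_def)
  obtain p where p: "p \<in> G" using G by (auto simp: hbox_family_def)
  have lu: "l \<le> u" using l[OF p] u[OF p] posG[OF p i] by linarith
  have "g l = 0"
    unfolding g_def using l by (intro sum.neutral) (force simp: max_def)
  have "hboxes G \<inter> {x. x \<bullet> i < u} = hboxes G"
    using u i unfolding hboxes_def hbox_def by (blast intro: less_le_trans)
  then have "g u = measure lebesgue (hboxes G)"
    using g_eq[of u] by simp
  moreover have "continuous_on {l..u} g"
    unfolding g_def by (intro continuous_intros)
  moreover have "0 < measure lebesgue (hboxes G)"
    by (rule measure_hboxes_pos[OF G])
  ultimately obtain d where "g d = \<theta> * measure lebesgue (hboxes G)"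
    using IVT'[of g l "\<theta> * measure lebesgue (hboxes G)" u] \<open>g l = 0\<close> lu \<theta> by (auto simp: mult_le_cancel_right1)
  then show ?thesis
    using that g_eq by metis
qed

lemma minkowski_sum_commute: "minkowski_sum A B = minkowski_sum B (A::'a::ab_semigroup_add set)"
  unfolding minkowski_sum_def by (metis add.commute)

text \<open>The Hadwiger-Ohmann cut: a hyperplane separating two boxes of \<open>F\<close> leaves
  fewer boxes on either side, and \<open>G\<close> is cut by a parallel hyperplane in the same
  volume ratio \<open>\<theta>\<close>. The sums of corresponding parts lie on different sides of
  the hyperplane at height \<open>c + d\<close>, so their volumes add. By homogeneity the induction
  hypothesis gives \<open>\<theta> * R ^ n\<close> and
  \<open>(1 - \<theta>) * R ^ n\<close>.\<close>

lemma brunn_minkowski_hboxes_step: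
  fixes F G :: "('a::euclidean_space \<times> 'a) set"
  defines "n \<equiv> DIM('a)"
  assumes F: "hbox_family F" and G: "hbox_family G" and card: "2 \<le> card F"
    and IH: "\<And>F' G' :: ('a \<times> 'a) set. card F' + card G' < card F + card G \<Longrightarrow> hbox_family F' \<Longrightarrow> hbox_family G' \<Longrightarrow>
      root n (measure lebesgue (hboxes F')) + root n (measure lebesgue (hboxes G'))
        \<le> root n (measure lebesgue (minkowski_sum (hboxes F') (hboxes G')))"
  shows "root n (measure lebesgue (hboxes F)) + root n (measure lebesgue (hboxes G))
    \<le> root n (measure lebesgue (minkowski_sum (hboxes F) (hboxes G)))"
proof -
  have n: "0 < n" by (simp add: n_def)
  have finF: "finite F" and finG: "finite G" using F G by (simp_all add: hbox_family_def)
  have posF: "\<And>p j. p \<in> F \<Longrightarrow> j \<in> Basis \<Longrightarrow> fst p \<bullet> j < snd p \<bullet> j"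
    using F by (simp add: hbox_family_def)
  obtain p' q' where pq': "p' \<in> F" "q' \<in> F" "p' \<noteq> q'"
    using card card_le_Suc0_iff_eq[OF finF] by force
  have "hbox (fst p') (snd p') \<inter> hbox (fst q') (snd q') = {}"
    using F pq' unfolding hbox_family_def disjoint_family_on_def by blast
  then obtain i where i: "i \<in> Basis" and "snd p' \<bullet> i \<le> fst q' \<bullet> i \<or> snd q' \<bullet> i \<le> fst p' \<bullet> i"
    using hbox_separated[OF posF[OF pq'(1)] posF[OF pq'(2)]] by blast
  then obtain p q where pq: "p \<in> F" "q \<in> F" "snd p \<bullet> i \<le> fst q \<bullet> i"
    using pq' by blast
  \<comment> \<open>At this height the lower part of the cut discards \<open>q\<close> and the upper
    part discards \<open>p\<close>, so both parts have fewer boxes than \<open>F\<close>.\<close>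
  define c where "c = fst q \<bullet> i"
  define Fb Fa where "Fb = cut_below i c F" and "Fa = cut_above i c F"
  have "fst p \<bullet> i < c" "c < snd q \<bullet> i"
    using posF[OF pq(1) i] posF[OF pq(2) i] pq(3) by (simp_all add: c_def)
  then have Fb: "hbox_family Fb" and Fa: "hbox_family Fa"
    unfolding Fb_def Fa_def using hbox_family_cut_below[OF F i pq(1)] hbox_family_cut_above[OF F i pq(2)] by auto
  have cF: "card Fb < card F" "card Fa < card F"
    unfolding Fb_def Fa_def using card_cut_below_less[OF finF pq(2)] card_cut_above_less[OF finF pq(1)] pq(3)
    by (auto simp: c_def)
  define f g where "f = measure lebesgue (hboxes F)" and "g = measure lebesgue (hboxes G)"
  have fsplit: "f = measure lebesgue (hboxes Fb) + measure lebesgue (hboxes Fa)"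
    unfolding f_def Fb_def Fa_def by (rule measure_hboxes_halfspace_Un[OF finF i])
  have fg: "0 < f" "0 < g" unfolding f_def g_def using measure_hboxes_pos F G by auto
  define \<theta> where "\<theta> = measure lebesgue (hboxes Fb) / f"
  have mFb: "measure lebesgue (hboxes Fb) = \<theta> * f" and mFa: "measure lebesgue (hboxes Fa) = (1 - \<theta>) * f"
    using fsplit fg by (simp_all add: \<theta>_def field_simps)
  have \<theta>: "0 < \<theta>" "\<theta> < 1"
    using measure_hboxes_pos[OF Fb] measure_hboxes_pos[OF Fa] fg mFb mFa
    by (auto simp: zero_less_mult_iff)
  obtain d where "measure lebesgue (hboxes G \<inter> {x. x \<bullet> i < d}) = \<theta> * g"
    using hboxes_cut_fraction[OF G i \<theta>] unfolding g_def by blast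
  define Gb Ga where "Gb = cut_below i d G" and "Ga = cut_above i d G"
  have mGb: "measure lebesgue (hboxes Gb) = \<theta> * g"
    unfolding Gb_def hboxes_cut_below[OF i] by fact
  then have mGa: "measure lebesgue (hboxes Ga) = (1 - \<theta>) * g"
    using measure_hboxes_halfspace_Un[OF finG i, of d] unfolding Gb_def Ga_def g_def by (simp add: algebra_simps)
  have "Gb \<noteq> {}" "Ga \<noteq> {}"
    using mGb mGa \<theta> fg by (auto simp: hboxes_def)
  then obtain r s where "r \<in> G" "fst r \<bullet> i < d" "s \<in> G" "d < snd s \<bullet> i"
    unfolding Gb_def Ga_def cut_below_def cut_above_def by blast
  then have Gb: "hbox_family Gb" "card Gb \<le> card G" and Ga: "hbox_family Ga" "card Ga \<le> card G"
    unfolding Gb_def Ga_def using hbox_family_cut_below[OF G i] hbox_family_cut_above[OF G i] by auto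
  define R where "R = root n f + root n g"
  have R: "0 \<le> R" using fg n by (simp add: R_def)
  \<comment> \<open>Scaling both volumes by the same factor \<open>t\<close> scales the sum of roots
    by \<open>root n t\<close>, which becomes \<open>t\<close> in the \<open>n\<close>-th
    power.\<close>
  have IH': "t * R ^ n \<le> measure lebesgue (minkowski_sum (hboxes F') (hboxes G'))"
    if "hbox_family F'" "hbox_family G'" "card F' < card F" "card G' \<le> card G" "0 < t"
      "measure lebesgue (hboxes F') = t * f" "measure lebesgue (hboxes G') = t * g" for t and F' G' :: "('a \<times> 'a) set"
  proof -
    have "root n t * R = root n (t * f) + root n (t * g)"
      by (simp add: R_def real_root_mult algebra_simps)
    also have "\<dots> \<le> root n (measure lebesgue (minkowski_sum (hboxes F') (hboxes G')))"
      using IH[of F' G'] that by simp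
    finally have "(root n t * R) ^ n \<le> root n (measure lebesgue (minkowski_sum (hboxes F') (hboxes G'))) ^ n"
      using that(5) R n by (intro power_mono) auto
    then show ?thesis
      using n that(5) by (simp add: power_mult_distrib)
  qed
  have below: "\<theta> * R ^ n \<le> measure lebesgue (minkowski_sum (hboxes Fb) (hboxes Gb))"
    using IH' Fb Gb cF \<theta> mFb mGb by blast
  have above: "(1 - \<theta>) * R ^ n \<le> measure lebesgue (minkowski_sum (hboxes Fa) (hboxes Ga))"
    using IH'[of Fa Ga "1 - \<theta>"] Fa Ga cF \<theta> mFa mGa by simp
  have disj: "minkowski_sum (hboxes Fb) (hboxes Gb) \<inter> minkowski_sum (hboxes Fa) (hboxes Ga) = {}"
  proof -
    have "z \<bullet> i < c + d" if "z \<in> minkowski_sum (hboxes Fb) (hboxes Gb)" for z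
      using that unfolding minkowski_sum_def Fb_def Gb_def hboxes_cut_below[OF i]
      by (auto simp: inner_add_left)
    moreover have "c + d \<le> z \<bullet> i" if "z \<in> minkowski_sum (hboxes Fa) (hboxes Ga)" for z
      using that unfolding minkowski_sum_def Fa_def Ga_def hboxes_cut_above[OF i]
      by (auto simp: inner_add_left)
    ultimately show ?thesis by (meson disjoint_iff not_le)
  qed
  have "R ^ n \<le> measure lebesgue (minkowski_sum (hboxes Fb) (hboxes Gb)) + measure lebesgue (minkowski_sum (hboxes Fa) (hboxes Ga))"
    using below above by (simp add: algebra_simps)
  also have "\<dots> = measure lebesgue (minkowski_sum (hboxes Fb) (hboxes Gb) \<union> minkowski_sum (hboxes Fa) (hboxes Ga))"
    using disj by (simp add: measure_Un3 minkowski_sum_hboxes_lmeasurable Fa Fb Ga Gb)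
  also have "\<dots> \<le> measure lebesgue (minkowski_sum (hboxes F) (hboxes G))"
  proof (rule measure_mono_fmeasurable)
    have "hboxes Fb \<subseteq> hboxes F" "hboxes Fa \<subseteq> hboxes F" "hboxes Gb \<subseteq> hboxes G" "hboxes Ga \<subseteq> hboxes G"
      unfolding Fb_def Gb_def Fa_def Ga_def hboxes_cut_below[OF i] hboxes_cut_above[OF i] by auto
    then show "minkowski_sum (hboxes Fb) (hboxes Gb) \<union> minkowski_sum (hboxes Fa) (hboxes Ga) \<subseteq> minkowski_sum (hboxes F) (hboxes G)"
      unfolding minkowski_sum_def by blast
  qed (auto intro!: sets.Un fmeasurableD minkowski_sum_hboxes_lmeasurable F G Fa Fb Ga Gb)
  finally have "root n (R ^ n) \<le> root n (measure lebesgue (minkowski_sum (hboxes F) (hboxes G)))"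
    using n by simp
  then show ?thesis
    using n R by (simp add: real_root_power_cancel R_def f_def g_def)
qed

text \<open>Induction on the total number of boxes. Commutativity of the sum lets the cut start from
  whichever family has two boxes; two single boxes are the case of
  \<open>root_prod_add_le\<close>.\<close>

lemma brunn_minkowski_hboxes:
  fixes F G :: "('a::euclidean_space \<times> 'a) set"
  assumes "hbox_family F" "hbox_family G"
  shows "root DIM('a) (measure lebesgue (hboxes F)) + root DIM('a) (measure lebesgue (hboxes G))
    \<le> root DIM('a) (measure lebesgue (minkowski_sum (hboxes F) (hboxes G)))"
  using assms
proof (induction "card F + card G" arbitrary: F G rule: less_induct)
  case less
  consider "2 \<le> card F" | "2 \<le> card G" | "card F = 1" "card G = 1"
  proof -
    have "card F > 0" "card G > 0"
      using less.prems by (auto simp: hbox_family_def card_gt_0_iff)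
    then show ?thesis using that by linarith
  qed
  then show ?case
  proof cases
    case 1
    then show ?thesis
      using brunn_minkowski_hboxes_step[OF less.prems] less.hyps by blast
  next
    case 2
    have "root DIM('a) (measure lebesgue (hboxes G)) + root DIM('a) (measure lebesgue (hboxes F))
      \<le> root DIM('a) (measure lebesgue (minkowski_sum (hboxes G) (hboxes F)))"
    proof (rule brunn_minkowski_hboxes_step[OF less.prems(2,1) 2])
      fix F' G' :: "('a \<times> 'a) set"
      assume "card F' + card G' < card G + card F" and fam: "hbox_family F'" "hbox_family G'"
      then have "card F' + card G' < card F + card G" by linarith
      then show "root DIM('a) (measure lebesgue (hboxes F')) + root DIM('a) (measure lebesgue (hboxes G'))
        \<le> root DIM('a) (measure lebesgue (minkowski_sum (hboxes F') (hboxes G')))"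
        using less.hyps fam by blast
    qed
    then show ?thesis
      by (subst minkowski_sum_commute) linarith
  next
    case 3
    then obtain p q where pq: "F = {p}" "G = {q}" by (auto simp: card_1_singleton_iff)
    have p: "\<And>i. i \<in> Basis \<Longrightarrow> fst p \<bullet> i < snd p \<bullet> i" and q: "\<And>i. i \<in> Basis \<Longrightarrow> fst q \<bullet> i < snd q \<bullet> i"
      using less.prems pq by (auto simp: hbox_family_def)
    have "measure lebesgue (hboxes F) = (\<Prod>i\<in>Basis. (snd p - fst p) \<bullet> i)"
      "measure lebesgue (hboxes G) = (\<Prod>i\<in>Basis. (snd q - fst q) \<bullet> i)"
      using p q by (simp_all add: hboxes_def pq measure_hbox less_imp_le)
    moreover have "measure lebesgue (minkowski_sum (hboxes F) (hboxes G))
        = (\<Prod>i\<in>Basis. (snd p - fst p) \<bullet> i + (snd q - fst q) \<bullet> i)"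
    proof -
      have "minkowski_sum (hboxes F) (hboxes G) = hbox (fst p + fst q) (snd p + snd q)"
        using minkowski_sum_hbox[OF p q] by (simp add: hboxes_def pq)
      also have "measure lebesgue \<dots> = (\<Prod>i\<in>Basis. (snd p + snd q - (fst p + fst q)) \<bullet> i)"
        using p q by (intro measure_hbox) (simp add: inner_add_left add_mono less_imp_le)
      also have "\<dots> = (\<Prod>i\<in>Basis. (snd p - fst p) \<bullet> i + (snd q - fst q) \<bullet> i)"
        by (rule prod.cong) (simp_all add: inner_diff_left inner_add_left)
      finally show ?thesis .
    qed
    moreover have "root DIM('a) (\<Prod>i\<in>Basis. (snd p - fst p) \<bullet> i) + root DIM('a) (\<Prod>i\<in>Basis. (snd q - fst q) \<bullet> i)
      \<le> root DIM('a) (\<Prod>i\<in>Basis. (snd p - fst p) \<bullet> i + (snd q - fst q) \<bullet> i)"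
      by (rule root_prod_add_le) (use p q in \<open>auto simp: inner_diff_left\<close>)
    ultimately show ?thesis by simp
  qed
qed

section \<open>From boxes to compact sets by grid covers\<close>

definition grid_point :: "real \<Rightarrow> 'a::euclidean_space \<Rightarrow> 'a" where
  "grid_point N x = (\<Sum>i\<in>Basis. (real_of_int \<lfloor>N * (x \<bullet> i)\<rfloor> / N) *\<^sub>R i)"

text \<open>These are the half-open grid cells of side \<open>1 / N\<close> that meet
  \<open>A\<close>. Points in a common cell yield the same pair, which makes the family finite for
  bounded \<open>A\<close>.\<close>

definition grid_cover :: "real \<Rightarrow> 'a::euclidean_space set \<Rightarrow> ('a \<times> 'a) set" where
  "grid_cover N A = (\<lambda>x. (grid_point N x, grid_point N x + (1 / N) *\<^sub>R One)) ` A"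

lemma grid_point_inner: "i \<in> Basis \<Longrightarrow> grid_point N x \<bullet> i = real_of_int \<lfloor>N * (x \<bullet> i)\<rfloor> / N"
  by (simp add: grid_point_def)

lemma grid_point_eq_iff:
  assumes "0 < N"
  shows "grid_point N x = grid_point N y \<longleftrightarrow> (\<forall>i\<in>Basis. \<lfloor>N * (x \<bullet> i)\<rfloor> = \<lfloor>N * (y \<bullet> i)\<rfloor>)"
  unfolding euclidean_eq_iff[where x = "grid_point N x"] using assms by (simp add: grid_point_inner)

lemma hbox_grid_point:
  assumes "0 < N"
  shows "hbox (grid_point N x) (grid_point N x + (1 / N) *\<^sub>R One) = {y. grid_point N y = grid_point N x}"
proof -
  have "real_of_int k / N \<le> t \<and> t < real_of_int k / N + 1 / N \<longleftrightarrow> \<lfloor>N * t\<rfloor> = k" for k t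
    unfolding floor_eq_iff using assms by (simp add: field_simps)
  then show ?thesis
    unfolding hbox_def grid_point_eq_iff[OF assms]
    by (simp add: inner_add_left grid_point_inner cong: ball_cong)
qed

lemma finite_grid_cover:
  fixes A :: "'a::euclidean_space set"
  assumes "bounded A" "0 < N"
  shows "finite (grid_cover N A)"
proof -
  obtain B where B: "\<And>x. x \<in> A \<Longrightarrow> norm x \<le> B"
    using assms(1) by (auto simp: bounded_iff)
  define T where "T = (\<lambda>z. real_of_int z / N) ` {\<lfloor>- (N * B)\<rfloor>..\<lfloor>N * B\<rfloor>}"
  have "grid_point N ` A \<subseteq> (\<lambda>f. \<Sum>i\<in>Basis. f i *\<^sub>R i) ` (Basis \<rightarrow>\<^sub>E T)"
  proof
    fix y assume "y \<in> grid_point N ` A"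
    then obtain x where x: "x \<in> A" "y = grid_point N x" by blast
    define f where "f = restrict (\<lambda>i. real_of_int \<lfloor>N * (x \<bullet> i)\<rfloor> / N) (Basis :: 'a set)"
    have "\<bar>x \<bullet> i\<bar> \<le> B" if "i \<in> Basis" for i
      using Basis_le_norm[OF that, of x] B[OF x(1)] by simp
    then have "\<bar>N * (x \<bullet> i)\<bar> \<le> N * B" if "i \<in> Basis" for i
      using that assms(2) by (simp add: abs_mult)
    then have "f \<in> Basis \<rightarrow>\<^sub>E T"
      unfolding f_def T_def by (force intro!: floor_mono)
    moreover have "y = (\<Sum>i\<in>Basis. f i *\<^sub>R i)"
      unfolding x grid_point_def by (rule sum.cong) (simp_all add: f_def)
    ultimately show "y \<in> (\<lambda>f. \<Sum>i\<in>Basis. f i *\<^sub>R i) ` (Basis \<rightarrow>\<^sub>E T)" by blast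
  qed
  moreover have "finite (Basis \<rightarrow>\<^sub>E T :: ('a \<Rightarrow> real) set)"
    by (intro finite_PiE) (simp_all add: T_def)
  ultimately have "finite (grid_point N ` A)"
    using finite_surj by blast
  moreover have "grid_cover N A = (\<lambda>y. (y, y + (1 / N) *\<^sub>R One)) ` grid_point N ` A"
    by (simp add: grid_cover_def image_image)
  ultimately show ?thesis by simp
qed

lemma hboxes_grid_cover: "0 < N \<Longrightarrow> hboxes (grid_cover N A) = {y. \<exists>x\<in>A. grid_point N y = grid_point N x}"
  unfolding hboxes_def grid_cover_def by (simp add: hbox_grid_point) blast

lemma hbox_family_grid_cover:
  assumes "bounded A" "A \<noteq> {}" "0 < N"
  shows "hbox_family (grid_cover N A)"
  unfolding hbox_family_def
proof (intro conjI)
  show "finite (grid_cover N A)" by (rule finite_grid_cover[OF assms(1,3)])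
  show "grid_cover N A \<noteq> {}" using assms(2) by (simp add: grid_cover_def)
  show "\<forall>p\<in>grid_cover N A. \<forall>i\<in>Basis. fst p \<bullet> i < snd p \<bullet> i"
    using assms(3) by (simp add: grid_cover_def inner_add_left)
  show "disjoint_family_on (\<lambda>p. hbox (fst p) (snd p)) (grid_cover N A)"
    unfolding disjoint_family_on_def grid_cover_def
    using assms(3) by (auto simp: hbox_grid_point)
qed

lemma grid_point_eq_imp_close:
  fixes x y :: "'a::euclidean_space"
  assumes "0 < N" "grid_point N x = grid_point N y"
  shows "norm (x - y) \<le> DIM('a) / N"
proof -
  have "\<bar>(x - y) \<bullet> i\<bar> \<le> 1 / N" if "i \<in> Basis" for i
  proof -
    have "\<lfloor>N * (x \<bullet> i)\<rfloor> = \<lfloor>N * (y \<bullet> i)\<rfloor>"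
      using assms that by (simp add: grid_point_eq_iff)
    then have "\<bar>N * (x \<bullet> i) - N * (y \<bullet> i)\<bar> \<le> 1" by linarith
    then have "N * \<bar>(x - y) \<bullet> i\<bar> \<le> 1"
      using assms(1) by (simp add: inner_diff_left right_diff_distrib[symmetric] abs_mult)
    then show ?thesis using assms(1) by (simp add: field_simps)
  qed
  then have "(\<Sum>i\<in>Basis. \<bar>(x - y) \<bullet> i\<bar>) \<le> (\<Sum>i\<in>(Basis::'a set). 1 / N)"
    by (rule sum_mono)
  then show ?thesis
    using norm_le_l1[of "x - y"] by simp
qed

text \<open>Grid covers of \<open>A\<close> and \<open>B\<close> contain these sets, and the sum of
  the covers lies in a small closed neighbourhood of the compact sum \<open>S\<close>. The
  inequality for boxes bounds the volumes of these neighbourhoods from below, and they decrease to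
  \<open>S\<close>.\<close>

theorem brunn_minkowski:
  fixes A B :: "'a::euclidean_space set"
  assumes A: "compact A" "A \<noteq> {}" and B: "compact B" "B \<noteq> {}"
  shows "root DIM('a) (measure lebesgue A) + root DIM('a) (measure lebesgue B)
    \<le> root DIM('a) (measure lebesgue (minkowski_sum A B))"
proof -
  define n where "n = DIM('a)"
  have n: "0 < n" by (simp add: n_def)
  define S where "S = minkowski_sum A B"
  have S: "compact S" "S \<noteq> {}"
    using compact_sums[OF A(1) B(1)] A(2) B(2) by (auto simp: S_def minkowski_sum_def)
  \<comment> \<open>With grid width \<open>1 / (k + 1)\<close> a point of a cover is within
    \<open>n / (k + 1)\<close> of its set; the factor 2 accounts for the two summands.\<close>
  define C where "C k = {z. infdist z S \<le> 2 * n / real (Suc k)}" for k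
  have C: "compact (C k)" for k
    unfolding C_def using n by (intro compact_infdist_le S) auto
  have root_le: "root n (measure lebesgue A) + root n (measure lebesgue B) \<le> root n (measure lebesgue (C k))" for k
  proof -
    define N where "N = real (Suc k)"
    have N: "0 < N" by (simp add: N_def)
    define F G where "F = grid_cover N A" and "G = grid_cover N B"
    have F: "hbox_family F" and G: "hbox_family G"
      unfolding F_def G_def using A B N by (auto intro: hbox_family_grid_cover compact_imp_bounded)
    have mono: "measure lebesgue X \<le> measure lebesgue (hboxes (grid_cover N X))" if "compact X" for X :: "'a set"
    proof (rule measure_mono_fmeasurable)
      show "X \<subseteq> hboxes (grid_cover N X)" unfolding hboxes_grid_cover[OF N] by blast
      show "hboxes (grid_cover N X) \<in> lmeasurable"
        by (intro hboxes_lmeasurable finite_grid_cover compact_imp_bounded that N)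
    qed (intro fmeasurableD lmeasurable_compact that)
    have sub: "minkowski_sum (hboxes F) (hboxes G) \<subseteq> C k"
    proof
      fix z assume "z \<in> minkowski_sum (hboxes F) (hboxes G)"
      then obtain x y a b where z: "z = x + y" and ab: "a \<in> A" "b \<in> B"
        and g: "grid_point N x = grid_point N a" "grid_point N y = grid_point N b"
        unfolding minkowski_sum_def F_def G_def hboxes_grid_cover[OF N] by blast
      have "a + b \<in> S" using ab by (auto simp: S_def minkowski_sum_def)
      then have "infdist z S \<le> dist z (a + b)" by (rule infdist_le)
      also have "\<dots> \<le> norm (x - a) + norm (y - b)"
        unfolding z dist_norm by (metis add_diff_add norm_triangle_ineq)
      also have "\<dots> \<le> n / N + n / N"
        unfolding n_def by (intro add_mono grid_point_eq_imp_close N g)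
      finally show "z \<in> C k" by (simp add: C_def N_def)
    qed
    have "root n (measure lebesgue A) + root n (measure lebesgue B)
        \<le> root n (measure lebesgue (hboxes F)) + root n (measure lebesgue (hboxes G))"
      unfolding F_def G_def using n mono A B by (intro add_mono) auto
    also have "\<dots> \<le> root n (measure lebesgue (minkowski_sum (hboxes F) (hboxes G)))"
      unfolding n_def by (rule brunn_minkowski_hboxes[OF F G])
    also have "\<dots> \<le> root n (measure lebesgue (C k))"
      using n by (simp add: measure_mono_fmeasurable[OF sub] fmeasurableD minkowski_sum_hboxes_lmeasurable
          F G lmeasurable_compact C del: measure_completion)
    finally show ?thesis .
  qed
  have "(\<lambda>k. measure lebesgue (C k)) \<longlonglongrightarrow> measure lebesgue (\<Inter>k. C k)"
  proof (rule Lim_measure_decseq)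
    show "range C \<subseteq> sets lebesgue" using C by (blast intro: fmeasurableD lmeasurable_compact)
    show "decseq C"
    proof (rule decseq_SucI)
      have "2 * n / real (Suc (Suc k)) \<le> 2 * n / real (Suc k)" for k
        by (rule divide_left_mono) auto
      then show "C (Suc k) \<subseteq> C k" for k
        unfolding C_def by (auto intro: order_trans simp del: of_nat_Suc)
    qed
    show "emeasure lebesgue (C k) \<noteq> \<infinity>" for k
      using fmeasurableD2[OF lmeasurable_compact[OF C]] by simp
  qed
  moreover have "(\<Inter>k. C k) = S"
  proof (intro equalityI subsetI)
    fix z assume z: "z \<in> (\<Inter>k. C k)"
    have "(\<lambda>k. real (2 * n) * (1 / real (Suc k))) \<longlonglongrightarrow> real (2 * n) * 0"
      by (intro tendsto_intros LIMSEQ_inverse_real_of_nat[unfolded inverse_eq_divide])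
    then have "infdist z S \<le> real (2 * n) * 0"
      by (rule LIMSEQ_le_const) (use z in \<open>auto simp: C_def\<close>)
    then show "z \<in> S"
      using in_closed_iff_infdist_zero[OF compact_imp_closed[OF S(1)] S(2)] infdist_nonneg[of z S] by simp
  qed (use S in \<open>auto simp: C_def\<close>)
  ultimately have "(\<lambda>k. root n (measure lebesgue (C k))) \<longlonglongrightarrow> root n (measure lebesgue S)"
    by (intro tendsto_intros) simp
  then have "root n (measure lebesgue A) + root n (measure lebesgue B) \<le> root n (measure lebesgue S)"
    by (rule LIMSEQ_le_const) (use root_le in blast)
  then show ?thesis by (simp add: n_def S_def)
qed

section \<open>Support functions and mixed volumes\<close>

lemma bdd_above_inner_image:
  fixes L :: "'a::euclidean_space set"
  assumes "compact L"
  shows "bdd_above ((\<bullet>) u ` L)"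
  by (intro bounded_imp_bdd_above compact_imp_bounded compact_continuous_image continuous_intros assms)

lemma support_function_le_iff:
  fixes L :: "'a::euclidean_space set"
  assumes "compact L" "L \<noteq> {}"
  shows "support_function L u \<le> a \<longleftrightarrow> (\<forall>y\<in>L. u \<bullet> y \<le> a)"
  unfolding support_function_def by (rule cSUP_le_iff[OF assms(2) bdd_above_inner_image[OF assms(1)]])

lemma inner_le_support_function:
  fixes L :: "'a::euclidean_space set"
  assumes "compact L" "y \<in> L"
  shows "u \<bullet> y \<le> support_function L u"
  using assms support_function_le_iff[of L u "support_function L u"] by auto

text \<open>Sublevel sets are intersections of closed half-spaces, hence closed.\<close>

lemma borel_measurable_support_function:
  fixes L :: "'a::euclidean_space set"
  assumes "compact L" "L \<noteq> {}"
  shows "support_function L \<in> borel_measurable borel"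
proof (rule borel_measurableI_le)
  fix a
  have "{u. support_function L u \<le> a} = (\<Inter>y\<in>L. {u. y \<bullet> u \<le> a})"
    using support_function_le_iff[OF assms] by (auto simp: inner_commute)
  then have "closed {u. support_function L u \<le> a}"
    by (simp add: closed_INT closed_halfspace_le)
  then show "{u \<in> space borel. support_function L u \<le> a} \<in> sets borel"
    by simp
qed

lemma support_function_bounded:
  fixes L :: "'a::euclidean_space set"
  assumes "compact L" "0 \<in> L"
  obtains B where "\<And>u. u \<in> sphere 0 1 \<Longrightarrow> 0 \<le> support_function L u \<and> support_function L u \<le> B"
proof -
  obtain B where B: "\<And>y. y \<in> L \<Longrightarrow> norm y \<le> B"
    using compact_imp_bounded[OF assms(1)] by (auto simp: bounded_iff)
  have "support_function L u \<le> B" if "u \<in> sphere 0 1" for u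
  proof (subst support_function_le_iff)
    have "u \<bullet> y \<le> B" if "y \<in> L" for y
      using norm_cauchy_schwarz[of u y] B[OF that] \<open>u \<in> sphere 0 1\<close> by simp
    then show "\<forall>y\<in>L. u \<bullet> y \<le> B" by blast
  qed (use assms in auto)
  moreover have "0 \<le> support_function L u" for u
    using inner_le_support_function[OF assms, of u] by simp
  ultimately show ?thesis using that by blast
qed

lemma measure_scaleR_image:
  fixes L :: "'a::euclidean_space set"
  shows "measure lebesgue ((*\<^sub>R) t ` L) = \<bar>t\<bar> ^ DIM('a) * measure lebesgue L"
  using measure_lebesgue_affine[of t 0 L] by (simp add: image_def)

section \<open>Integrals of support functions against the surface area measure\<close>

context convex_body
begin

definition level :: "('a \<Rightarrow> real) \<Rightarrow> real \<Rightarrow> 'a set" where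
  "level g c = {u \<in> sphere 0 1. g u = c}"

lemma measurable_S: "g \<in> borel_measurable borel \<Longrightarrow> g \<in> borel_measurable S"
  using measurable_cong_sets[OF sets_S refl] measurable_restrict_space1 by blast

lemma integrable_S:
  assumes "g \<in> borel_measurable borel" "\<And>u. u \<in> sphere 0 1 \<Longrightarrow> \<bar>g u\<bar> \<le> (B::real)"
  shows "integrable S g"
proof -
  interpret finite_measure S by (rule finite_measure_S)
  show ?thesis
    by (rule integrable_const_bound[of _ B])
      (use assms measurable_S in \<open>auto simp: space_S intro!: AE_I2\<close>)
qed

lemma level_borel:
  assumes "g \<in> borel_measurable borel"
  shows "level g c \<in> sets borel" "level g c \<in> sets S"
proof -
  have "level g c = sphere 0 1 \<inter> g -` {c}"
    by (auto simp: level_def)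
  then show "level g c \<in> sets borel"
    using measurable_sets_borel[OF assms, of "{c}"] by simp
  then show "level g c \<in> sets S"
    by (auto simp: in_sets_S_iff level_def)
qed

text \<open>For finitely many values the integral is a finite combination of \<open>sarea\<close>
  values, each of which can be compared with shell volumes directly.\<close>

lemma integral_S_finite_range:
  assumes g: "g \<in> borel_measurable borel" and fin: "finite (g ` sphere 0 1)"
  shows "(\<integral>u. g u \<partial>S) = (\<Sum>c\<in>g ` sphere 0 1. c * sarea (level g c))"
proof -
  interpret finite_measure S by (rule finite_measure_S)
  have "(\<integral>u. g u \<partial>S) = (\<integral>u. (\<Sum>c\<in>g ` sphere 0 1. c * indicator (level g c) u) \<partial>S)"
  proof (rule Bochner_Integration.integral_cong)
    fix u assume "u \<in> space S"
    then have u: "u \<in> sphere 0 1" by (simp add: space_S)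
    have "(\<Sum>c\<in>g ` sphere 0 1. c * indicator (level g c) u) = (\<Sum>c\<in>g ` sphere 0 1. if c = g u then c else 0)"
      by (rule sum.cong) (use u in \<open>auto simp: level_def indicator_def\<close>)
    also have "\<dots> = g u"
      using fin u by (simp add: sum.delta)
    finally show "g u = (\<Sum>c\<in>g ` sphere 0 1. c * indicator (level g c) u)" by simp
  qed simp
  also have "\<dots> = (\<Sum>c\<in>g ` sphere 0 1. \<integral>u. c * indicator (level g c) u \<partial>S)"
    using level_borel[OF g] by (intro Bochner_Integration.integral_sum integrable_mult_right integrable_real_indicator)
      (auto simp: emeasure_finite less_top[symmetric])
  also have "\<dots> = (\<Sum>c\<in>g ` sphere 0 1. c * sarea (level g c))"
    using level_borel[OF g] by (simp add: measure_S sets.Int_space_eq2)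
  finally show ?thesis .
qed

text \<open>For \<open>z = k + \<epsilon> *\<^sub>R y\<close> outside \<open>K\<close>, the
  supporting hyperplane at \<open>P z\<close> gives \<open>d z \<le> \<epsilon> * (N z \<bullet> y)
  \<le> \<epsilon> * g (N z)\<close>. So \<open>z\<close> lies in the shell of that thickness over
  the level set of \<open>g\<close> containing \<open>N z\<close>.\<close>

lemma measure_minkowski_sum_le:
  assumes g: "g \<in> borel_measurable borel" and fin: "finite (g ` sphere 0 1)"
    and L: "compact L" "L \<noteq> {}" and gL: "\<And>u. u \<in> sphere 0 1 \<Longrightarrow> support_function L u \<le> g u"
    and \<epsilon>: "0 < \<epsilon>"
  shows "measure lebesgue (minkowski_sum K ((*\<^sub>R) \<epsilon> ` L))
    \<le> measure lebesgue K + (\<Sum>c\<in>g ` sphere 0 1. pvol (level g c) (\<epsilon> * c))"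
proof -
  define U where "U = (\<Union>c\<in>g ` sphere 0 1. shell K 0 (\<epsilon> * c) (level g c))"
  have sh: "shell K 0 (\<epsilon> * c) (level g c) \<in> lmeasurable" for c
    by (intro shell_lmeasurable level_borel g)
  have U: "U \<in> lmeasurable"
    unfolding U_def by (rule fmeasurable.finite_UN[OF fin sh])
  have Km: "K \<in> lmeasurable" by (rule lmeasurable_compact[OF compact_K])
  have "minkowski_sum K ((*\<^sub>R) \<epsilon> ` L) \<subseteq> K \<union> U"
  proof
    fix z assume "z \<in> minkowski_sum K ((*\<^sub>R) \<epsilon> ` L)"
    then obtain k y where ky: "k \<in> K" "y \<in> L" "z = k + \<epsilon> *\<^sub>R y"
      by (auto simp: minkowski_sum_def)
    show "z \<in> K \<union> U"
    proof (cases "0 < d z")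
      case True
      have N: "N z \<in> sphere 0 1" using norm_N[OF True] by simp
      have "d z = N z \<bullet> z - N z \<bullet> P z" using inner_N_decomp[OF True] by simp
      also have "\<dots> \<le> \<epsilon> * (N z \<bullet> y)"
        using N_inner_le[OF ky(1), of z] ky(3) by (simp add: inner_add_right)
      also have "\<dots> \<le> \<epsilon> * g (N z)"
        using \<epsilon> inner_le_support_function[OF L(1) ky(2), of "N z"] gL[OF N]
        by (intro mult_left_mono) auto
      finally have "z \<in> shell K 0 (\<epsilon> * g (N z)) (level g (g (N z)))"
        using True N by (simp add: shell_def level_def)
      then show ?thesis using N unfolding U_def by blast
    next
      case False
      then have "z \<in> K"
        using in_closed_iff_infdist_zero[OF closed_K nonempty_K] infdist_nonneg[of z K] by simp
      then show ?thesis by blast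
    qed
  qed
  then have "measure lebesgue (minkowski_sum K ((*\<^sub>R) \<epsilon> ` L)) \<le> measure lebesgue (K \<union> U)"
  proof (rule measure_mono_fmeasurable)
    have "compact (minkowski_sum K ((*\<^sub>R) \<epsilon> ` L))"
      unfolding minkowski_sum_def by (intro compact_sums compact_K compact_scaling L)
    then show "minkowski_sum K ((*\<^sub>R) \<epsilon> ` L) \<in> sets lebesgue"
      by (intro fmeasurableD lmeasurable_compact)
  qed (intro fmeasurable.Un U Km)
  also have "\<dots> \<le> measure lebesgue K + measure lebesgue U"
    by (intro measure_Un_le fmeasurableD U Km)
  also have "measure lebesgue U \<le> (\<Sum>c\<in>g ` sphere 0 1. pvol (level g c) (\<epsilon> * c))"
    unfolding U_def pvol_def by (rule measure_UNION_le[OF fin]) (intro fmeasurableD sh)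
  finally show ?thesis by simp
qed

lemma pvol_0: "pvol \<omega> 0 = 0"
proof -
  have "shell K 0 0 \<omega> = {}" by (auto simp: shell_def)
  then show ?thesis by (simp add: pvol_def)
qed

lemma tendsto_pvol_scaled:
  assumes "\<omega> \<in> sets borel" "0 \<le> c"
  shows "((\<lambda>\<epsilon>. pvol \<omega> (\<epsilon> * c) / \<epsilon>) \<longlongrightarrow> c * sarea \<omega>) (at_right 0)"
proof (cases "c = 0")
  case False
  then have c: "0 < c" using assms by simp
  have "filterlim (\<lambda>\<epsilon>. c * \<epsilon>) (at_right 0) (at_right (0::real))"
    by (rule filterlim_times_pos[OF filterlim_ident c]) simp
  then have "((\<lambda>\<epsilon>. pvol \<omega> (c * \<epsilon>) / (c * \<epsilon>)) \<longlongrightarrow> sarea \<omega>) (at_right 0)"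
    by (rule filterlim_compose[OF tendsto_sarea[OF assms(1)]])
  then have "((\<lambda>\<epsilon>. c * (pvol \<omega> (c * \<epsilon>) / (c * \<epsilon>))) \<longlongrightarrow> c * sarea \<omega>) (at_right 0)"
    by (rule tendsto_mult_left)
  then show ?thesis using c by (simp add: mult.commute)
qed (simp add: pvol_0)

text \<open>First-order expansion of the Brunn-Minkowski inequality for \<open>K\<close> plus
  \<open>\<epsilon>\<close> times \<open>L\<close>: Bernoulli's inequality bounds the volume gain
  below by \<open>\<epsilon> * (n * k ^ (n - 1) * l)\<close>, and the shells bound it above.
  Dividing by \<open>\<epsilon>\<close> and letting it tend to 0 turns the shell volumes into the
  integral of \<open>g\<close>.\<close>

lemma minkowski_first_simple:
  assumes g: "g \<in> borel_measurable borel" and fin: "finite (g ` sphere 0 1)"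
    and L: "compact L" "L \<noteq> {}"
    and gL: "\<And>u. u \<in> sphere 0 1 \<Longrightarrow> support_function L u \<le> g u"
    and g0: "\<And>u. u \<in> sphere 0 1 \<Longrightarrow> 0 \<le> g u" and K0: "0 < measure lebesgue K"
  shows "DIM('a) * root DIM('a) (measure lebesgue K) ^ (DIM('a) - 1) * root DIM('a) (measure lebesgue L) \<le> (\<integral>u. g u \<partial>S)"
proof -
  define n where "n = DIM('a)"
  have n: "0 < n" by (simp add: n_def)
  define k l where "k = root n (measure lebesgue K)" and "l = root n (measure lebesgue L)"
  have k: "0 < k" and l: "0 \<le> l" and kn: "k ^ n = measure lebesgue K"
    using n K0 by (simp_all add: k_def l_def)
  have bound: "n * k ^ (n - 1) * l \<le> (\<Sum>c\<in>g ` sphere 0 1. pvol (level g c) (\<epsilon> * c) / \<epsilon>)" if \<epsilon>: "0 < \<epsilon>" for \<epsilon>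
  proof -
    have "root n (\<epsilon> ^ n * measure lebesgue L) = \<epsilon> * l"
      using n \<epsilon> by (simp add: real_root_mult l_def real_root_power_cancel)
    then have "k + \<epsilon> * l \<le> root n (measure lebesgue (minkowski_sum K ((*\<^sub>R) \<epsilon> ` L)))"
      using brunn_minkowski[OF compact_K nonempty_K, of "(*\<^sub>R) \<epsilon> ` L"] L \<epsilon>
      by (simp add: compact_scaling measure_scaleR_image k_def n_def)
    then have "(k + \<epsilon> * l) ^ n \<le> root n (measure lebesgue (minkowski_sum K ((*\<^sub>R) \<epsilon> ` L))) ^ n"
      using k l \<epsilon> by (intro power_mono) auto
    also have "\<dots> = measure lebesgue (minkowski_sum K ((*\<^sub>R) \<epsilon> ` L))"
      using n by simp
    also have "\<dots> \<le> k ^ n + (\<Sum>c\<in>g ` sphere 0 1. pvol (level g c) (\<epsilon> * c))"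
      using measure_minkowski_sum_le[OF g fin L gL \<epsilon>] by (simp add: kn)
    finally have 1: "(k + \<epsilon> * l) ^ n \<le> k ^ n + (\<Sum>c\<in>g ` sphere 0 1. pvol (level g c) (\<epsilon> * c))" .
    have "1 + real n * (\<epsilon> * l / k) \<le> (1 + \<epsilon> * l / k) ^ n"
      by (rule Bernoulli_inequality) (use k l \<epsilon> in \<open>auto intro: order_trans[of _ 0]\<close>)
    then have "k ^ n * (1 + real n * (\<epsilon> * l / k)) \<le> k ^ n * (1 + \<epsilon> * l / k) ^ n"
      using k by (intro mult_left_mono) auto
    also have "\<dots> = (k + \<epsilon> * l) ^ n"
      using k by (simp add: power_mult_distrib[symmetric] distrib_left)
    also have "k ^ n * (1 + real n * (\<epsilon> * l / k)) = k ^ n + \<epsilon> * (n * k ^ (n - 1) * l)"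
      using k power_minus_mult[OF n, of k] by (simp add: field_simps)
    finally have "\<epsilon> * (n * k ^ (n - 1) * l) \<le> (\<Sum>c\<in>g ` sphere 0 1. pvol (level g c) (\<epsilon> * c))"
      using 1 by linarith
    then show ?thesis
      using \<epsilon> by (simp add: sum_divide_distrib[symmetric] field_simps)
  qed
  have "((\<lambda>\<epsilon>. \<Sum>c\<in>g ` sphere 0 1. pvol (level g c) (\<epsilon> * c) / \<epsilon>) \<longlongrightarrow> (\<Sum>c\<in>g ` sphere 0 1. c * sarea (level g c))) (at_right 0)"
    using g0 by (intro tendsto_sum tendsto_pvol_scaled level_borel g) auto
  then have "n * k ^ (n - 1) * l \<le> (\<Sum>c\<in>g ` sphere 0 1. c * sarea (level g c))"
    by (rule tendsto_lowerbound) (use bound in \<open>auto intro!: eventually_at_rightI[of 0 1]\<close>)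
  then show ?thesis
    unfolding integral_S_finite_range[OF g fin] by (simp add: k_def l_def n_def)
qed

lemma finite_range_round:
  fixes h :: "'a \<Rightarrow> real" and r :: "real \<Rightarrow> int"
  assumes "mono r" and b: "\<And>u. u \<in> sphere 0 1 \<Longrightarrow> a \<le> h u \<and> h u \<le> B" and \<delta>: "0 < \<delta>"
  shows "finite ((\<lambda>u. \<delta> * real_of_int (r (h u / \<delta>))) ` sphere 0 1)"
proof -
  have "(\<lambda>u. \<delta> * real_of_int (r (h u / \<delta>))) ` sphere 0 1
      \<subseteq> (\<lambda>z. \<delta> * real_of_int z) ` {r (a / \<delta>)..r (B / \<delta>)}"
    using b \<delta> by (auto intro!: imageI monoD[OF assms(1)] divide_right_mono)
  then show ?thesis by (rule finite_subset) simp
qed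

text \<open>Rounding the support function up to multiples of \<open>\<delta>\<close> gives a
  finite-range majorant that exceeds it by at most \<open>\<delta>\<close>, so the integrals differ
  by at most \<open>\<delta>\<close> times the total mass.\<close>

lemma minkowski_first:
  assumes L: "compact L" "0 \<in> L" and K0: "0 < measure lebesgue K"
  shows "DIM('a) * root DIM('a) (measure lebesgue K) ^ (DIM('a) - 1) * root DIM('a) (measure lebesgue L)
    \<le> (\<integral>u. support_function L u \<partial>S)" (is "?lhs \<le> _")
proof (rule field_le_epsilon)
  fix e :: real assume e: "0 < e"
  interpret finite_measure S by (rule finite_measure_S)
  \<comment> \<open>The summand 1 keeps the denominator positive even for total mass 0, and the
    total error stays at most \<open>e\<close>.\<close>
  define \<delta> where "\<delta> = e / (measure S (space S) + 1)"
  have \<delta>: "0 < \<delta>" using e by (simp add: \<delta>_def add_nonneg_pos)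
  obtain B where B: "\<And>u. u \<in> sphere 0 1 \<Longrightarrow> 0 \<le> support_function L u \<and> support_function L u \<le> B"
    using support_function_bounded[OF L] by blast
  have L': "L \<noteq> {}" using L by auto
  note [measurable] = borel_measurable_support_function[OF L(1) L']
  define g where "g u = \<delta> * real_of_int \<lceil>support_function L u / \<delta>\<rceil>" for u
  have g: "g \<in> borel_measurable borel" unfolding g_def by measurable
  have fin: "finite (g ` sphere 0 1)"
    unfolding g_def by (rule finite_range_round[OF _ B \<delta>]) (simp_all add: mono_def ceiling_mono)
  have ge: "support_function L u \<le> g u" for u
    using \<delta> mult_left_mono[OF le_of_int_ceiling[of "support_function L u / \<delta>"], of \<delta>] by (simp add: g_def)
  have le: "g u \<le> support_function L u + \<delta>" for u
    using \<delta> mult_left_mono[OF of_int_ceiling_le_add_one[of "support_function L u / \<delta>"], of \<delta>]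
    by (simp add: g_def distrib_left)
  have intL: "integrable S (support_function L)"
    by (rule integrable_S[of _ B]) (use B in auto)
  have "?lhs \<le> (\<integral>u. g u \<partial>S)"
    by (rule minkowski_first_simple[OF g fin L(1) L' ge _ K0]) (use B ge order_trans in blast)
  also have "\<dots> \<le> (\<integral>u. support_function L u + \<delta> \<partial>S)"
  proof (rule integral_mono)
    show "integrable S g"
    proof (rule integrable_S[OF g])
      fix u :: 'a assume "u \<in> sphere 0 1"
      then show "\<bar>g u\<bar> \<le> B + \<delta>" using B[of u] ge[of u] le[of u] by linarith
    qed
  qed (use intL le in auto)
  also have "\<dots> = (\<integral>u. support_function L u \<partial>S) + \<delta> * measure S (space S)"
    using intL by simp
  also have "\<delta> * measure S (space S) \<le> \<delta> * (measure S (space S) + 1)"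
    using \<delta> by simp
  also have "\<dots> = e"
    by (simp add: \<delta>_def add_nonneg_eq_0_iff)
  finally show "?lhs \<le> (\<integral>u. support_function L u \<partial>S) + e" by simp
qed

text \<open>The copy \<open>D'\<close> of the parallel body \<open>D\<close> contracted by
  \<open>1 + \<epsilon>\<close> misses the outer shells \<open>T\<close>: multiplying
  \<open>x\<close> in \<open>T\<close> by \<open>1 + \<epsilon>\<close> moves it outward along
  \<open>N x\<close> by at least \<open>\<epsilon> * g (N x)\<close>, beyond distance
  \<open>\<rho>\<close>. Hence \<open>T\<close> has volume at most that of \<open>D\<close> minus
  that of \<open>D'\<close>, which is at most \<open>n * \<epsilon>\<close> times the volume of
  \<open>D\<close>. Monotonicity of the shell ratios bounds the volume of \<open>T\<close> below by
  \<open>\<epsilon>\<close> times the integral, for this one \<open>\<epsilon>\<close>.\<close>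

lemma cone_volume_simple:
  assumes g: "g \<in> borel_measurable borel" and fin: "finite (g ` sphere 0 1)"
    and gK: "\<And>u. u \<in> sphere 0 1 \<Longrightarrow> g u \<le> support_function K u"
    and g0: "\<And>u. u \<in> sphere 0 1 \<Longrightarrow> 0 \<le> g u" and K0: "0 \<in> K" and \<rho>: "0 < \<rho>"
  shows "(\<integral>u. g u \<partial>S) \<le> DIM('a) * measure lebesgue {x. d x \<le> \<rho>}"
proof -
  define n where "n = DIM('a)"
  define R where "R = g ` sphere 0 1"
  have finR: "finite R" and R0: "\<And>c. c \<in> R \<Longrightarrow> 0 \<le> c" using fin g0 by (auto simp: R_def)
  obtain M where M: "0 \<le> M" "\<And>c. c \<in> R \<Longrightarrow> c \<le> M"
  proof
    show "c \<le> Max (insert 0 R)" if "c \<in> R" for c using finR that by simp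
    show "0 \<le> Max (insert 0 R)" using finR by simp
  qed
  \<comment> \<open>This choice makes \<open>\<epsilon> * c < \<rho>\<close> for every value
    \<open>c\<close> of \<open>g\<close>, so all shells in \<open>T\<close> stay at positive
    distance from \<open>K\<close>.\<close>
  define \<epsilon> where "\<epsilon> = \<rho> / (M + 1)"
  have \<epsilon>: "0 < \<epsilon>" using \<rho> M by (simp add: \<epsilon>_def)
  have \<epsilon>c: "\<epsilon> * c < \<rho>" if "c \<in> R" for c
  proof -
    have "\<rho> * c \<le> \<rho> * M" using M(2)[OF that] \<rho> by simp
    also have "\<dots> < \<rho> * (M + 1)" using \<rho> by simp
    finally show ?thesis using M(1) by (simp add: \<epsilon>_def divide_less_eq)
  qed
  define D where "D = {x. d x \<le> \<rho>}"
  define D' where "D' = (*\<^sub>R) (1 / (1 + \<epsilon>)) ` D"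
  define T where "T = (\<Union>c\<in>R. shell K (\<rho> - \<epsilon> * c) \<rho> (level g c))"
  have D: "D \<in> lmeasurable" and D': "D' \<in> lmeasurable"
    unfolding D'_def D_def by (intro lmeasurable_compact compact_scaling compact_parallel)+
  have sh: "shell K (\<rho> - \<epsilon> * c) \<rho> (level g c) \<in> lmeasurable" for c
    by (intro shell_lmeasurable level_borel g)
  have T: "T \<in> lmeasurable"
    unfolding T_def by (rule fmeasurable.finite_UN[OF finR sh])
  have "\<epsilon> * (\<integral>u. g u \<partial>S) = (\<Sum>c\<in>R. \<epsilon> * c * sarea (level g c))"
    unfolding integral_S_finite_range[OF g fin] R_def[symmetric] by (simp add: sum_distrib_left mult.assoc)
  also have "\<dots> \<le> (\<Sum>c\<in>R. measure lebesgue (shell K (\<rho> - \<epsilon> * c) \<rho> (level g c)))"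
  proof (rule sum_mono)
    fix c assume c: "c \<in> R"
    let ?\<omega> = "level g c"
    have \<omega>: "?\<omega> \<in> sets borel" by (rule level_borel[OF g])
    have a: "0 < \<rho> - \<epsilon> * c" "\<rho> - \<epsilon> * c \<le> \<rho>" using \<epsilon>c[OF c] R0[OF c] \<epsilon> by auto
    have "pvol ?\<omega> (\<rho> - \<epsilon> * c) / (\<rho> - \<epsilon> * c) \<le> pvol ?\<omega> \<rho> / \<rho>"
      by (rule pvol_ratio_mono[OF \<omega> a])
    then have "pvol ?\<omega> (\<rho> - \<epsilon> * c) \<le> pvol ?\<omega> \<rho> / \<rho> * (\<rho> - \<epsilon> * c)"
      using a by (simp only: pos_divide_le_eq)
    also have "\<dots> = pvol ?\<omega> \<rho> - \<epsilon> * c * (pvol ?\<omega> \<rho> / \<rho>)"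
      using \<rho> by (simp add: field_simps)
    finally have "\<epsilon> * c * (pvol ?\<omega> \<rho> / \<rho>) \<le> pvol ?\<omega> \<rho> - pvol ?\<omega> (\<rho> - \<epsilon> * c)" by simp
    also have "\<dots> = measure lebesgue (shell K (\<rho> - \<epsilon> * c) \<rho> ?\<omega>)"
      using pvol_split[OF \<omega>, of "\<rho> - \<epsilon> * c" \<rho>] a by simp
    finally show "\<epsilon> * c * sarea ?\<omega> \<le> measure lebesgue (shell K (\<rho> - \<epsilon> * c) \<rho> ?\<omega>)"
      using mult_left_mono[OF sarea_le[OF \<rho>, of ?\<omega>], of "\<epsilon> * c"] \<epsilon> R0[OF c] by simp
  qed
  also have "\<dots> = measure lebesgue T"
    unfolding T_def
  proof (rule measure_finite_Union[OF finR, symmetric])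
    show "disjoint_family_on (\<lambda>c. shell K (\<rho> - \<epsilon> * c) \<rho> (level g c)) R"
      unfolding disjoint_family_on_def shell_def level_def by auto
    show "(\<lambda>c. shell K (\<rho> - \<epsilon> * c) \<rho> (level g c)) ` R \<subseteq> sets lebesgue"
      using sh by (blast intro: fmeasurableD)
    show "emeasure lebesgue (shell K (\<rho> - \<epsilon> * c) \<rho> (level g c)) \<noteq> \<infinity>" for c
      using fmeasurableD2[OF sh] by simp
  qed
  finally have int_le: "\<epsilon> * (\<integral>u. g u \<partial>S) \<le> measure lebesgue T" .
  have "T \<inter> D' = {}"
  proof -
    have "x \<notin> D'" if xT: "x \<in> T" for x
    proof
      assume "x \<in> D'"
      then have "d ((1 + \<epsilon>) *\<^sub>R x) \<le> \<rho>" using \<epsilon> by (auto simp: D'_def D_def)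
      obtain c where c: "c \<in> R" "\<rho> - \<epsilon> * c < d x" "N x \<in> sphere 0 1" "g (N x) = c"
        using xT by (auto simp: T_def shell_def level_def)
      have dx: "0 < d x" using c(2) \<epsilon>c[OF c(1)] by simp
      \<comment> \<open>Since \<open>P x\<close> maximises the inner product with \<open>N x\<close>
        over \<open>K\<close>, the height \<open>N x \<bullet> x\<close> is at least
        \<open>c\<close>; this is the rate at which dilation pushes \<open>x\<close>
        outward.\<close>
      have "support_function K (N x) \<le> N x \<bullet> P x"
        using N_inner_le by (simp add: support_function_le_iff[OF compact_K nonempty_K])
      then have "c \<le> N x \<bullet> x" using gK[OF c(3)] c(4) dx inner_N_decomp[OF dx] by simp
      then have "\<epsilon> * c \<le> \<epsilon> * (N x \<bullet> x)" using \<epsilon> by simp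
      then have "\<rho> < d x + \<epsilon> * (N x \<bullet> x)" using c(2) by simp
      also have "\<dots> = N x \<bullet> ((1 + \<epsilon>) *\<^sub>R x) - N x \<bullet> P x"
        using inner_N_decomp[OF dx] by (simp add: algebra_simps)
      also have "\<dots> \<le> d ((1 + \<epsilon>) *\<^sub>R x)" by (rule d_ge[OF dx])
      finally show False using \<open>d ((1 + \<epsilon>) *\<^sub>R x) \<le> \<rho>\<close> by simp
    qed
    then show ?thesis by blast
  qed
  moreover have "T \<subseteq> D" by (auto simp: T_def D_def shell_def)
  moreover have "D' \<subseteq> D"
  proof
    fix x assume "x \<in> D'"
    then obtain y where y: "x = (1 / (1 + \<epsilon>)) *\<^sub>R y" "d y \<le> \<rho>" by (auto simp: D'_def D_def)
    have s: "0 \<le> 1 / (1 + \<epsilon>)" "1 / (1 + \<epsilon>) \<le> 1" using \<epsilon> by auto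
    have "(1 / (1 + \<epsilon>)) *\<^sub>R P y \<in> K"
      using convexD[OF convex_K P_in[of y] K0, of "1 / (1 + \<epsilon>)" "1 - 1 / (1 + \<epsilon>)"] s by simp
    then have "d x \<le> dist x ((1 / (1 + \<epsilon>)) *\<^sub>R P y)" by (rule infdist_le)
    also have "\<dots> = norm ((1 / (1 + \<epsilon>)) *\<^sub>R (y - P y))"
      by (simp only: y dist_norm scaleR_diff_right)
    also have "\<dots> = 1 / (1 + \<epsilon>) * d y"
      using s by (simp only: norm_scaleR d_eq abs_of_nonneg)
    also have "\<dots> \<le> 1 * d y" using s by (intro mult_right_mono infdist_nonneg)
    finally show "x \<in> D" using y by (simp add: D_def)
  qed
  ultimately have "measure lebesgue T + measure lebesgue D' \<le> measure lebesgue D"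
    using measure_Un3[OF T D'] measure_mono_fmeasurable[of "T \<union> D'" D lebesgue] T D D'
    by (simp add: fmeasurableD del: measure_completion)
  moreover have "measure lebesgue D' = (1 / (1 + \<epsilon>)) ^ n * measure lebesgue D"
    unfolding D'_def measure_scaleR_image using \<epsilon> by (simp add: n_def)
  moreover have "(1 - real n * \<epsilon>) * measure lebesgue D \<le> (1 / (1 + \<epsilon>)) ^ n * measure lebesgue D"
  proof (rule mult_right_mono)
    have eq: "1 / (1 + \<epsilon>) = 1 + - (\<epsilon> / (1 + \<epsilon>))" using \<epsilon> by (simp add: field_simps)
    have "1 + real n * - (\<epsilon> / (1 + \<epsilon>)) \<le> (1 + - (\<epsilon> / (1 + \<epsilon>))) ^ n"
      by (rule Bernoulli_inequality) (use \<epsilon> in simp)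
    moreover have "real n * (\<epsilon> / (1 + \<epsilon>)) \<le> real n * \<epsilon>"
      using \<epsilon> by (intro mult_left_mono) (auto simp: field_simps)
    ultimately show "1 - real n * \<epsilon> \<le> (1 / (1 + \<epsilon>)) ^ n" unfolding eq by simp
  qed simp
  ultimately have "\<epsilon> * (\<integral>u. g u \<partial>S) \<le> \<epsilon> * (n * measure lebesgue D)"
    using int_le by (simp add: algebra_simps)
  then show ?thesis using \<epsilon> by (simp add: n_def D_def)
qed

text \<open>Round the support function down to multiples of \<open>\<delta>\<close>, which keeps it
  nonnegative, and apply \<open>cone_volume_simple\<close> with \<open>\<rho> = 1 / (k + 1)\<close>.
  The parallel bodies decrease to \<open>K\<close>, and then the rounding error is arbitrarily
  small.\<close>

lemma integral_support_function_self_le: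
  assumes K0: "0 \<in> K"
  shows "(\<integral>u. support_function K u \<partial>S) \<le> DIM('a) * measure lebesgue K"
proof (rule field_le_epsilon)
  fix e :: real assume e: "0 < e"
  interpret finite_measure S by (rule finite_measure_S)
  define \<delta> where "\<delta> = e / (measure S (space S) + 1)"
  have \<delta>: "0 < \<delta>" using e by (simp add: \<delta>_def add_nonneg_pos)
  obtain B where B: "\<And>u. u \<in> sphere 0 1 \<Longrightarrow> 0 \<le> support_function K u \<and> support_function K u \<le> B"
    using support_function_bounded[OF compact_K K0] by blast
  note [measurable] = borel_measurable_support_function[OF compact_K nonempty_K]
  define g where "g u = \<delta> * real_of_int \<lfloor>support_function K u / \<delta>\<rfloor>" for u
  have g: "g \<in> borel_measurable borel" unfolding g_def by measurable
  have fin: "finite (g ` sphere 0 1)"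
    unfolding g_def by (rule finite_range_round[OF _ B \<delta>]) (simp_all add: mono_def floor_mono)
  have le: "g u \<le> support_function K u" for u
    using \<delta> mult_left_mono[OF of_int_floor_le[of "support_function K u / \<delta>"], of \<delta>] by (simp add: g_def)
  have ge: "support_function K u - \<delta> \<le> g u" for u
  proof -
    have "support_function K u / \<delta> - 1 \<le> real_of_int \<lfloor>support_function K u / \<delta>\<rfloor>" by linarith
    then have "\<delta> * (support_function K u / \<delta> - 1) \<le> g u"
      unfolding g_def using \<delta> by (intro mult_left_mono) auto
    then show ?thesis using \<delta> by (simp add: right_diff_distrib)
  qed
  have g0: "0 \<le> g u" if "u \<in> sphere 0 1" for u
    using B[OF that] \<delta> by (simp add: g_def)
  have intK: "integrable S (support_function K)"
    by (rule integrable_S[of _ B]) (use B in auto)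
  have intg: "integrable S g"
  proof (rule integrable_S[OF g])
    fix u :: 'a assume "u \<in> sphere 0 1"
    then show "\<bar>g u\<bar> \<le> B" using B[of u] g0[of u] le[of u] by linarith
  qed
  have lim: "(\<lambda>k. measure lebesgue {x. d x \<le> 1 / real (Suc k)}) \<longlonglongrightarrow> measure lebesgue (\<Inter>k. {x. d x \<le> 1 / real (Suc k)})"
  proof (rule Lim_measure_decseq)
    have fm: "{x. d x \<le> 1 / real (Suc k)} \<in> lmeasurable" for k
      by (intro lmeasurable_compact compact_parallel)
    then show "range (\<lambda>k. {x. d x \<le> 1 / real (Suc k)}) \<subseteq> sets lebesgue"
      by (blast intro: fmeasurableD)
    show "emeasure lebesgue {x. d x \<le> 1 / real (Suc k)} \<noteq> \<infinity>" for k
      using fmeasurableD2[OF fm] by simp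
    show "decseq (\<lambda>k. {x. d x \<le> 1 / real (Suc k)})"
    proof (rule decseq_SucI)
      have "1 / real (Suc (Suc k)) \<le> 1 / real (Suc k)" for k
        by (rule divide_left_mono) auto
      then show "{x. d x \<le> 1 / real (Suc (Suc k))} \<subseteq> {x. d x \<le> 1 / real (Suc k)}" for k
        by (auto intro: order_trans simp del: of_nat_Suc)
    qed
  qed
  have "(\<Inter>k. {x. d x \<le> 1 / real (Suc k)}) = K"
  proof (intro equalityI subsetI)
    fix z assume z: "z \<in> (\<Inter>k. {x. d x \<le> 1 / real (Suc k)})"
    have "d z \<le> 0"
      by (rule LIMSEQ_le_const[OF LIMSEQ_inverse_real_of_nat[unfolded inverse_eq_divide]]) (use z in auto)
    then show "z \<in> K"
      using in_closed_iff_infdist_zero[OF closed_K nonempty_K] infdist_nonneg[of z K] by simp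
  qed auto
  with lim have "(\<lambda>k. measure lebesgue {x. d x \<le> 1 / real (Suc k)}) \<longlonglongrightarrow> measure lebesgue K"
    by (simp only:)
  then have lim: "(\<lambda>k. DIM('a) * measure lebesgue {x. d x \<le> 1 / real (Suc k)}) \<longlonglongrightarrow> DIM('a) * measure lebesgue K"
    by (rule tendsto_mult_left)
  have "(\<integral>u. support_function K u \<partial>S) - \<delta> * measure S (space S) = (\<integral>u. support_function K u - \<delta> \<partial>S)"
    using intK by simp
  also have "\<dots> \<le> (\<integral>u. g u \<partial>S)"
    by (rule integral_mono) (use intK intg ge in auto)
  also have "\<dots> \<le> DIM('a) * measure lebesgue K"
    by (rule LIMSEQ_le_const[OF lim]) (use cone_volume_simple[OF g fin le g0 K0] in auto)
  finally have "(\<integral>u. support_function K u \<partial>S) \<le> DIM('a) * measure lebesgue K + \<delta> * measure S (space S)" by simp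
  also have "\<delta> * measure S (space S) \<le> \<delta> * (measure S (space S) + 1)"
    using \<delta> by simp
  also have "\<dots> = e"
    by (simp add: \<delta>_def add_nonneg_eq_0_iff)
  finally show "(\<integral>u. support_function K u \<partial>S) \<le> DIM('a) * measure lebesgue K + e" by simp
qed

end

text \<open>Equal volumes make \<open>M - A\<close> null, so the open set
  \<open>interior M - A\<close> is empty. A convex set with interior points lies in the closure of
  its interior, and \<open>A\<close> is closed.\<close>

lemma convex_subset_of_measure_le:
  fixes A M :: "'a::euclidean_space set"
  assumes A: "closed A" "A \<subseteq> M" and M: "compact M" "convex M" "interior M \<noteq> {}"
    and le: "measure lebesgue M \<le> measure lebesgue A"
  shows "M \<subseteq> A"
proof -
  have Mm: "M \<in> lmeasurable" by (rule lmeasurable_compact[OF M(1)])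
  have "compact A" using A M(1) by (metis compact_Int_closed inf.absorb2)
  then have Am: "A \<in> lmeasurable" by (rule lmeasurable_compact)
  have "measure lebesgue (M - A) = 0"
    using measurable_measure_Diff[OF Mm fmeasurableD[OF Am] A(2)] le measure_nonneg[of lebesgue "M - A"] by linarith
  then have "negligible (M - A)"
    using Mm Am by (simp add: negligible_iff_measure fmeasurable_Diff fmeasurableD)
  then have "negligible (interior M - A)"
    by (rule negligible_subset) (use interior_subset in blast)
  moreover have "open (interior M - A)" using A(1) by (simp add: open_Diff)
  ultimately have "interior M \<subseteq> A" using open_not_negligible by blast
  then have "closure (interior M) \<subseteq> A" using A(1) by (rule closure_minimal)
  then show ?thesis
    using convex_closure_interior[OF M(2,3)] closure_subset by blast
qed

lemma support_function_scaleR_image: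
  fixes L :: "'a::euclidean_space set"
  assumes L: "compact L" "L \<noteq> {}" and t: "0 < t"
  shows "support_function ((*\<^sub>R) t ` L) u = t * support_function L u"
proof -
  have "support_function ((*\<^sub>R) t ` L) u \<le> a \<longleftrightarrow> t * support_function L u \<le> a" for a
  proof -
    have "support_function ((*\<^sub>R) t ` L) u \<le> a \<longleftrightarrow> (\<forall>y\<in>L. u \<bullet> y \<le> a / t)"
      using L t by (subst support_function_le_iff) (auto simp: compact_scaling pos_le_divide_eq mult.commute)
    also have "\<dots> \<longleftrightarrow> support_function L u \<le> a / t"
      by (simp only: support_function_le_iff[OF L])
    finally show ?thesis
      using t by (simp add: pos_le_divide_eq mult.commute)
  qed
  then show ?thesis by (meson order.antisym order.refl)
qed

text \<open>For \<open>s > 0\<close> the infimum of the difference quotients to the right of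
  \<open>s\<close> is the slope of a supporting line; evaluating that line at 0 gives
  \<open>m * s \<ge> \<phi> s \<ge> 0\<close>. At the endpoint \<open>s = 0\<close> the slope 0
  works because \<open>\<phi>\<close> is nonnegative.\<close>

lemma Orlicz_class_subgradient:
  assumes "\<phi> \<in> Orlicz_class" "0 \<le> s"
  obtains m where "0 \<le> m" "\<And>t. 0 \<le> t \<Longrightarrow> \<phi> s + m * (t - s) \<le> \<phi> t"
proof (cases "s = 0")
  case True
  then show ?thesis
    using assms by (intro that[of 0]) (auto simp: Orlicz_class_def)
next
  case False
  then have s: "0 < s" using assms by simp
  define m where "m = Inf ((\<lambda>t. (\<phi> s - \<phi> t) / (s - t)) ` ({s<..} \<inter> {0..}))"
  have sub: "\<phi> s + m * (t - s) \<le> \<phi> t" if "0 \<le> t" for t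
    unfolding m_def using assms s that
    by (intro convex_le_Inf_differential) (auto simp: Orlicz_class_def)
  have "0 \<le> \<phi> s" "\<phi> 0 = 0" using assms by (auto simp: Orlicz_class_def)
  then have "0 \<le> m * s" using sub[of 0] by simp
  then have "0 \<le> m" using s by (simp add: zero_le_mult_iff)
  then show ?thesis using that sub by blast
qed

section \<open>The Orlicz-Minkowski inequality and its equality cases\<close>

context convex_body
begin

text \<open>Minkowski's first inequality with \<open>L = K\<close> is the converse of
  \<open>integral_support_function_self_le\<close>.\<close>

lemma integral_support_function_self:
  assumes "0 \<in> interior K"
  shows "0 < measure lebesgue K" "(\<integral>u. support_function K u \<partial>S) = DIM('a) * measure lebesgue K"
proof -
  have "0 \<in> K" using assms interior_subset by blast
  obtain e where e: "0 < e" "ball 0 e \<subseteq> K" using assms by (auto simp: mem_interior)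
  have "0 < measure lebesgue (ball (0::'a) e)" using e content_ball_pos by simp
  also have "\<dots> \<le> measure lebesgue K"
    by (rule measure_mono_fmeasurable) (use e lmeasurable_compact[OF compact_K] in \<open>auto intro: fmeasurableD\<close>)
  finally show pos: "0 < measure lebesgue K" .
  have n: "0 < DIM('a)" by simp
  have "DIM('a) * measure lebesgue K = DIM('a) * root DIM('a) (measure lebesgue K) ^ (DIM('a) - 1) * root DIM('a) (measure lebesgue K)"
    using power_minus_mult[OF n, of "root DIM('a) (measure lebesgue K)"] pos by simp
  also have "\<dots> \<le> (\<integral>u. support_function K u \<partial>S)"
    by (rule minkowski_first[OF compact_K \<open>0 \<in> K\<close> pos])
  finally show "(\<integral>u. support_function K u \<partial>S) = DIM('a) * measure lebesgue K"
    using integral_support_function_self_le[OF \<open>0 \<in> K\<close>] by simp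
qed

lemma integrable_support_function:
  assumes "compact L" "0 \<in> L"
  shows "integrable S (support_function L)"
proof -
  obtain B where "\<And>u. u \<in> sphere 0 1 \<Longrightarrow> 0 \<le> support_function L u \<and> support_function L u \<le> B"
    using support_function_bounded[OF assms] by blast
  then show ?thesis
    using assms by (intro integrable_S[of _ B] borel_measurable_support_function) auto
qed

text \<open>Passing to the convex hull of the union turns an almost everywhere comparison of support
  functions into a comparison of volumes.\<close>

lemma subset_of_AE_support_function_le:
  assumes K0: "0 \<in> interior K" and L: "compact L" "0 \<in> L"
    and AE: "AE u in S. support_function L u \<le> support_function K u"
  shows "L \<subseteq> K"
proof -
  define n where "n = DIM('a)"
  have n: "0 < n" by (simp add: n_def)
  define M where "M = convex hull (K \<union> L)"
  have KL: "K \<union> L \<subseteq> M" unfolding M_def by (rule hull_subset)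
  have M: "compact M" "convex M" "K \<subseteq> M" "L \<subseteq> M" "0 \<in> M"
  proof -
    show "compact M" unfolding M_def by (intro compact_convex_hull compact_Un compact_K L)
    show "convex M" unfolding M_def by (rule convex_convex_hull)
  qed (use KL L(2) in blast)+
  define k where "k = root n (measure lebesgue K)"
  have pos: "0 < measure lebesgue K" by (rule integral_support_function_self[OF K0])
  have k: "0 < k" using pos n by (simp add: k_def)
  have hM: "support_function M u \<le> max (support_function K u) (support_function L u)" for u
  proof -
    have "M \<subseteq> {y. u \<bullet> y \<le> max (support_function K u) (support_function L u)}"
      unfolding M_def
    proof (rule hull_minimal)
      show "K \<union> L \<subseteq> {y. u \<bullet> y \<le> max (support_function K u) (support_function L u)}"
        using inner_le_support_function[OF compact_K, of _ u] inner_le_support_function[OF L(1), of _ u]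
        by (auto simp: le_max_iff_disj)
    qed (rule convex_halfspace_le)
    then show ?thesis
      using M by (subst support_function_le_iff) auto
  qed
  \<comment> \<open>The support function of \<open>M\<close> is almost everywhere at most that of
    \<open>K\<close>, so Minkowski's first inequality for \<open>M\<close> ends in the volume of
    \<open>K\<close> itself and bounds the volume of \<open>M\<close> by it.\<close>
  have "n * k ^ (n - 1) * root n (measure lebesgue M) \<le> (\<integral>u. support_function M u \<partial>S)"
    unfolding n_def k_def by (rule minkowski_first[OF M(1,5) pos])
  also have "\<dots> \<le> (\<integral>u. support_function K u \<partial>S)"
  proof (rule integral_mono_AE)
    show "AE u in S. support_function M u \<le> support_function K u"
      using AE by eventually_elim (metis hM max.absorb1)
  qed (use K0 interior_subset in \<open>auto intro!: integrable_support_function M compact_K\<close>)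
  also have "\<dots> = n * measure lebesgue K"
    by (simp add: integral_support_function_self[OF K0] n_def)
  also have "\<dots> = n * k ^ (n - 1) * k"
    using power_minus_mult[OF n, of k] n pos by (simp add: k_def)
  finally have "root n (measure lebesgue M) \<le> k" using n k by simp
  then have "measure lebesgue M \<le> measure lebesgue K" using n by (simp add: k_def)
  moreover have "interior M \<noteq> {}" using K0 interior_mono[OF M(3)] by blast
  ultimately have "M \<subseteq> K"
    using convex_subset_of_measure_le[OF closed_K M(3,1,2)] by blast
  then show ?thesis using M(4) by blast
qed

lemma scaled_subset_of_AE_support_function_le:
  assumes K0: "0 \<in> interior K" and L: "compact L" "0 \<in> L" and c: "0 < c"
    and AE: "AE u in S. support_function L u \<le> c * support_function K u"
  shows "L \<subseteq> (*\<^sub>R) c ` K"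
proof -
  have ne: "L \<noteq> {}" using L by auto
  have "(*\<^sub>R) (1 / c) ` L \<subseteq> K"
  proof (rule subset_of_AE_support_function_le[OF K0])
    show "AE u in S. support_function ((*\<^sub>R) (1 / c) ` L) u \<le> support_function K u"
      using AE by eventually_elim (use c in \<open>simp add: support_function_scaleR_image[OF L(1) ne] field_simps\<close>)
  qed (use L in \<open>auto simp: compact_scaling intro: image_eqI[of _ _ 0]\<close>)
  then have "(*\<^sub>R) c ` (*\<^sub>R) (1 / c) ` L \<subseteq> (*\<^sub>R) c ` K" by (rule image_mono)
  then show ?thesis using c by (simp add: image_image)
qed

lemma support_function_self_bounds:
  assumes "0 \<in> interior K"
  obtains r where "0 < r" "\<And>u. u \<in> sphere 0 1 \<Longrightarrow> r \<le> support_function K u"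
proof -
  obtain e where e: "0 < e" "cball 0 e \<subseteq> K" using assms by (auto simp: mem_interior_cball)
  have "e \<le> support_function K u" if "u \<in> sphere 0 1" for u
  proof -
    have "e *\<^sub>R u \<in> K" using that e by auto
    then show ?thesis
      using inner_le_support_function[OF compact_K, of "e *\<^sub>R u" u] that by (simp add: norm_eq_1)
  qed
  then show ?thesis using that e by blast
qed

lemma integrable_Orlicz:
  assumes K0: "0 \<in> interior K" and L: "compact L" "0 \<in> L" and \<phi>: "\<phi> \<in> Orlicz_class"
  shows "integrable S (\<lambda>u. \<phi> (support_function L u / support_function K u) * support_function K u)"
proof -
  have K0': "0 \<in> K" and ne: "L \<noteq> {}" using K0 L interior_subset by auto
  obtain r where r: "0 < r" "\<And>u. u \<in> sphere 0 1 \<Longrightarrow> r \<le> support_function K u"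
    using support_function_self_bounds[OF K0] by blast
  obtain A where A: "\<And>u. u \<in> sphere 0 1 \<Longrightarrow> 0 \<le> support_function K u \<and> support_function K u \<le> A"
    using support_function_bounded[OF compact_K K0'] by blast
  obtain B where B: "\<And>u. u \<in> sphere 0 1 \<Longrightarrow> 0 \<le> support_function L u \<and> support_function L u \<le> B"
    using support_function_bounded[OF L] by blast
  have mono: "\<phi> s \<le> \<phi> t" if "0 \<le> s" "s \<le> t" for s t
    using \<phi> that by (auto simp: Orlicz_class_def mono_on_def)
  have nonneg: "0 \<le> \<phi> t" if "0 \<le> t" for t
    using \<phi> that by (auto simp: Orlicz_class_def)
  note [measurable] = borel_measurable_support_function[OF compact_K nonempty_K]
    borel_measurable_support_function[OF L(1) ne]
  \<comment> \<open>\<open>\<phi>\<close> is monotone only on the nonnegative reals; composing with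
    \<open>max 0\<close> gives a monotone, hence Borel, function on the whole line. The quotient is
    nonnegative for every \<open>u\<close>, so the integrand is unchanged.\<close>
  have "mono (\<lambda>t. \<phi> (max 0 t))" by (intro monoI mono) auto
  then have [measurable]: "(\<lambda>t. \<phi> (max 0 t)) \<in> borel_measurable borel" by (rule borel_measurable_mono)
  have q0: "0 \<le> support_function L u / support_function K u" for u
    using inner_le_support_function[OF L, of u] inner_le_support_function[OF compact_K K0', of u] by simp
  have "(\<lambda>u. \<phi> (max 0 (support_function L u / support_function K u)) * support_function K u) \<in> borel_measurable borel"
    by measurable
  then have meas: "(\<lambda>u. \<phi> (support_function L u / support_function K u) * support_function K u) \<in> borel_measurable borel"
    using q0 by (simp add: max_absorb2)
  show ?thesis
  proof (rule integrable_S[OF meas])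
    fix u :: 'a assume u: "u \<in> sphere 0 1"
    have "support_function L u / support_function K u \<le> B / r"
      using B[OF u] r(1) r(2)[OF u] by (intro frac_le) auto
    then have "\<phi> (support_function L u / support_function K u) * support_function K u \<le> \<phi> (B / r) * A"
      using A[OF u] q0[of u] by (intro mult_mono mono nonneg) (auto intro: order_trans)
    moreover have "0 \<le> \<phi> (support_function L u / support_function K u) * support_function K u"
      using A[OF u] q0[of u] nonneg by simp
    ultimately show "\<bar>\<phi> (support_function L u / support_function K u) * support_function K u\<bar> \<le> \<phi> (B / r) * A"
      by simp
  qed
qed

text \<open>The gap \<open>G\<close> between the integrand and the supporting line of
  \<open>\<phi>\<close> at \<open>s\<close>, weighted by the support function of \<open>K\<close>,
  is nonnegative on the sphere. Since the slope \<open>m\<close> is nonnegative, Minkowski's first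
  inequality bounds its integral by \<open>n\<close> times the difference of the two sides. Equality
  makes \<open>G\<close> vanish almost everywhere, and a strictly convex \<open>\<phi>\<close>
  touches its supporting line only at \<open>s\<close>.\<close>

lemma Orlicz_minkowski:
  assumes K0: "0 \<in> interior K" and L: "compact L" "0 \<in> L" and \<phi>: "\<phi> \<in> Orlicz_class"
  defines "s \<equiv> root DIM('a) (measure lebesgue L / measure lebesgue K)"
  shows "measure lebesgue K * \<phi> s \<le> Orlicz_mixed_volume \<phi> K L"
    and "strictly_convex_on {0..} \<phi> \<Longrightarrow> Orlicz_mixed_volume \<phi> K L = measure lebesgue K * \<phi> s \<Longrightarrow>
      AE u in S. support_function L u = s * support_function K u"
proof -
  define n where "n = DIM('a)"
  have n: "0 < n" by (simp add: n_def)
  let ?hK = "support_function K" and ?hL = "support_function L"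
  define v where "v = measure lebesgue K"
  have v: "0 < v" and intK: "(\<integral>u. ?hK u \<partial>S) = n * v"
    using integral_support_function_self[OF K0] by (simp_all add: v_def n_def)
  have K0': "0 \<in> K" using K0 interior_subset by blast
  have s0: "0 \<le> s" using n by (simp add: s_def n_def)
  obtain m where m: "0 \<le> m" "\<And>t. 0 \<le> t \<Longrightarrow> \<phi> s + m * (t - s) \<le> \<phi> t"
    using Orlicz_class_subgradient[OF \<phi> s0] by blast
  \<comment> \<open>In terms of \<open>s\<close>, Minkowski's first inequality bounds the integral
    of the support function of \<open>L\<close> below by \<open>s\<close> times that of
    \<open>K\<close>.\<close>
  have "root n v ^ (n - 1) * root n (measure lebesgue L) = root n v ^ (n - 1) * (root n v * s)"
    using v n by (simp add: s_def v_def n_def real_root_divide)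
  also have "\<dots> = v * s"
    using power_minus_mult[OF n, of "root n v"] v n by simp
  finally have intL: "n * (v * s) \<le> (\<integral>u. ?hL u \<partial>S)"
    using minkowski_first[OF L] v by (simp add: v_def n_def mult.assoc)
  define G where "G u = \<phi> (?hL u / ?hK u) * ?hK u - ((\<phi> s - m * s) * ?hK u + m * ?hL u)" for u
  have iK: "integrable S ?hK" and iL: "integrable S ?hL"
    by (intro integrable_support_function compact_K K0' L)+
  note iO = integrable_Orlicz[OF K0 L \<phi>]
  have iG: "integrable S G"
    unfolding G_def using iK iL iO by simp
  have intG: "(\<integral>u. G u \<partial>S) = n * Orlicz_mixed_volume \<phi> K L - ((\<phi> s - m * s) * (n * v) + m * (\<integral>u. ?hL u \<partial>S))"
    unfolding G_def using iK iL iO n intK by (simp add: Orlicz_mixed_volume_def n_def)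
  have hK: "0 < ?hK u" if "u \<in> sphere 0 1" for u
    using support_function_self_bounds[OF K0] that by (metis less_le_trans)
  have hL: "0 \<le> ?hL u" for u
    using inner_le_support_function[OF L, of u] by simp
  have G_eq: "G u = (\<phi> (?hL u / ?hK u) - (\<phi> s + m * (?hL u / ?hK u - s))) * ?hK u" if "u \<in> sphere 0 1" for u
    using hK[OF that] by (simp add: G_def field_simps)
  have G0: "0 \<le> G u" if "u \<in> sphere 0 1" for u
    using m(2)[of "?hL u / ?hK u"] hK[OF that] hL[of u] by (simp add: G_eq[OF that])
  have "0 \<le> (\<integral>u. G u \<partial>S)"
    by (rule integral_nonneg_AE) (use G0 in \<open>auto simp: space_S intro!: AE_I2\<close>)
  moreover have mL: "m * (n * (v * s)) \<le> m * (\<integral>u. ?hL u \<partial>S)"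
    using m intL by (intro mult_left_mono)
  ultimately have "n * (v * \<phi> s) \<le> n * Orlicz_mixed_volume \<phi> K L"
    unfolding intG by (simp add: algebra_simps)
  then show "measure lebesgue K * \<phi> s \<le> Orlicz_mixed_volume \<phi> K L"
    using n by (simp add: v_def)
  assume strict: "strictly_convex_on {0..} \<phi>" and eq: "Orlicz_mixed_volume \<phi> K L = measure lebesgue K * \<phi> s"
  have "(\<integral>u. G u \<partial>S) \<le> 0"
    unfolding intG eq v_def[symmetric] using mL by (simp add: algebra_simps)
  then have "(\<integral>u. G u \<partial>S) = 0" using \<open>0 \<le> (\<integral>u. G u \<partial>S)\<close> by simp
  then have "AE u in S. G u = 0"
    by (subst (asm) integral_nonneg_eq_0_iff_AE[OF iG]) (use G0 in \<open>auto simp: space_S intro!: AE_I2\<close>)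
  then show "AE u in S. ?hL u = s * ?hK u"
  proof (rule AE_mp, intro AE_I2 impI)
    fix u assume "u \<in> space S" and Gu: "G u = 0"
    then have u: "u \<in> sphere 0 1" by (simp add: space_S)
    define t where "t = ?hL u / ?hK u"
    have t: "0 \<le> t" using hL[of u] hK[OF u] by (simp add: t_def)
    have "\<phi> t = \<phi> s + m * (t - s)"
      using Gu hK[OF u] by (simp add: G_eq[OF u] t_def)
    \<comment> \<open>The graph meets the supporting line at both \<open>t\<close> and
      \<open>s\<close>; if these differed, strict convexity would put it below the line at their
      midpoint.\<close>
    moreover have "\<phi> ((1/2) *\<^sub>R t + (1/2) *\<^sub>R s) < (1/2) * \<phi> t + (1/2) * \<phi> s" if "t \<noteq> s"
      using strict[unfolded strictly_convex_on_def, THEN conjunct2, rule_format, of t s "1/2" "1/2"] that t s0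
      by simp
    moreover have "\<phi> s + m * ((1/2) *\<^sub>R t + (1/2) *\<^sub>R s - s) \<le> \<phi> ((1/2) *\<^sub>R t + (1/2) *\<^sub>R s)"
      using t s0 by (intro m(2)) simp
    ultimately have "t = s"
      by (auto simp: algebra_simps)
    then show "?hL u = s * ?hK u" using hK[OF u] by (simp add: t_def field_simps)
  qed
qed

text \<open>Equality makes the support function of \<open>L\<close> equal to \<open>s\<close> times
  that of \<open>K\<close> almost everywhere. For \<open>s > 0\<close> this puts \<open>L\<close>
  inside the dilate of \<open>K\<close> by \<open>s\<close>, which has the same volume, so they
  coincide. For \<open>s = 0\<close> it puts \<open>L\<close> inside every dilate of
  \<open>K\<close>, which leaves only the origin. Conversely, for dilatates the quotient of support
  functions is the constant \<open>s\<close>.\<close>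

lemma Orlicz_minkowski_equality:
  assumes K0: "0 \<in> interior K" and L: "compact L" "0 \<in> L" and \<phi>: "\<phi> \<in> Orlicz_class"
    and strict: "strictly_convex_on {0..} \<phi>"
  defines "s \<equiv> root DIM('a) (measure lebesgue L / measure lebesgue K)"
  assumes L_convex: "convex L"
  shows "Orlicz_mixed_volume \<phi> K L = measure lebesgue K * \<phi> s \<longleftrightarrow> dilatates K L \<or> L = {0}"
proof
  define n where "n = DIM('a)"
  have n: "0 < n" by (simp add: n_def)
  have v: "0 < measure lebesgue K" by (rule integral_support_function_self[OF K0])
  have s0: "0 \<le> s" using n by (simp add: s_def n_def)
  have K0': "0 \<in> K" using K0 interior_subset by blast
  {
    assume "Orlicz_mixed_volume \<phi> K L = measure lebesgue K * \<phi> s"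
    then have AE: "AE u in S. support_function L u = s * support_function K u"
      using Orlicz_minkowski(2)[OF K0 L \<phi> strict] by (simp add: s_def)
    show "dilatates K L \<or> L = {0}"
    proof (cases "s = 0")
      case False
      then have s: "0 < s" using s0 by simp
      have sub: "L \<subseteq> (*\<^sub>R) s ` K"
        by (rule scaled_subset_of_AE_support_function_le[OF K0 L s]) (use AE in auto)
      have "s ^ n = measure lebesgue L / measure lebesgue K"
        using n by (simp add: s_def n_def)
      then have "measure lebesgue ((*\<^sub>R) s ` K) = measure lebesgue L"
        using s v by (simp add: measure_scaleR_image n_def[symmetric])
      moreover have "interior ((*\<^sub>R) s ` K) \<noteq> {}"
        using K0 s by (subst interior_injective_linear_image) (auto intro: linear_scaleR simp: inj_on_def)
      ultimately have "(*\<^sub>R) s ` K \<subseteq> L"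
        by (intro convex_subset_of_measure_le[OF compact_imp_closed[OF L(1)] sub
            compact_scaling[OF compact_K] convex_scaling[OF convex_K]]) simp_all
      then have "L = (*\<^sub>R) s ` K" using sub by blast
      then show ?thesis using s unfolding dilatates_def by blast
    next
      case True
      have "y = 0" if y: "y \<in> L" for y
      proof (rule ccontr)
        assume "y \<noteq> 0"
        obtain B where B: "\<And>z. z \<in> K \<Longrightarrow> norm z \<le> B"
          using compact_imp_bounded[OF compact_K] by (auto simp: bounded_iff)
        have B0: "0 \<le> B" using B[OF K0'] by simp
        \<comment> \<open>Points of \<open>K\<close> scaled by \<open>c\<close> have norm at most
          \<open>c * B\<close>, which is less than \<open>norm y\<close>; the summand 1 makes this
          strict and the denominator positive.\<close>
        define c where "c = norm y / (B + 1)"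
        have c: "0 < c" using \<open>y \<noteq> 0\<close> B0 by (simp add: c_def)
        have hK: "0 \<le> support_function K u" for u
          using inner_le_support_function[OF compact_K K0', of u] by simp
        have "L \<subseteq> (*\<^sub>R) c ` K"
        proof (rule scaled_subset_of_AE_support_function_le[OF K0 L c])
          show "AE u in S. support_function L u \<le> c * support_function K u"
            using AE by eventually_elim (use True c hK in simp)
        qed
        then obtain z where z: "z \<in> K" "y = c *\<^sub>R z" using y by blast
        have "norm y \<le> c * B" using z c B[OF z(1)] by simp
        also have "\<dots> < c * (B + 1)" using c by simp
        also have "\<dots> = norm y" using B0 by (simp add: c_def)
        finally show False by simp
      qed
      then have "L = {0}" using L(2) by blast
      then show ?thesis ..
    qed
  }
  assume "dilatates K L \<or> L = {0}"
  then show "Orlicz_mixed_volume \<phi> K L = measure lebesgue K * \<phi> s"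
  proof
    assume "dilatates K L"
    then obtain t where t: "0 < t" "L = (*\<^sub>R) t ` K" by (auto simp: dilatates_def)
    have "measure lebesgue L / measure lebesgue K = t ^ n"
      using t v by (simp add: measure_scaleR_image n_def)
    then have st: "s = t" using n t by (simp add: s_def n_def[symmetric] real_root_power_cancel)
    have "(\<integral>u. \<phi> (support_function L u / support_function K u) * support_function K u \<partial>S)
        = (\<integral>u. \<phi> t * support_function K u \<partial>S)"
    proof (rule Bochner_Integration.integral_cong)
      fix u assume "u \<in> space S"
      then have "u \<in> sphere 0 1" by (simp add: space_S)
      then have "0 < support_function K u"
        using support_function_self_bounds[OF K0] by (metis less_le_trans)
      then show "\<phi> (support_function L u / support_function K u) * support_function K u = \<phi> t * support_function K u"
        by (simp add: t support_function_scaleR_image[OF compact_K nonempty_K])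
    qed simp
    then show ?thesis
      using integral_support_function_self[OF K0] by (simp add: Orlicz_mixed_volume_def st)
  next
    assume L0: "L = {0}"
    have "\<phi> 0 = 0" using \<phi> by (simp add: Orlicz_class_def)
    then show ?thesis
      by (simp add: Orlicz_mixed_volume_def L0 support_function_def s_def)
  qed
qed

end

theorem theorem9p2:
  fixes K L :: "(real ^ 'n) set" and \<phi> :: "real \<Rightarrow> real"
  assumes "CARD('n) \<ge> 2"
    and "\<phi> \<in> Orlicz_class"
    and "compact K" and "convex K" and "0 \<in> interior K"
    and "compact L" and "convex L" and "0 \<in> L"
  shows "Orlicz_mixed_volume \<phi> K L
           \<ge> measure lebesgue K * \<phi> ((measure lebesgue L / measure lebesgue K) powr (1 / real CARD('n)))
       \<and> (strictly_convex_on {0..} \<phi> \<longrightarrow>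
           (Orlicz_mixed_volume \<phi> K L
              = measure lebesgue K * \<phi> ((measure lebesgue L / measure lebesgue K) powr (1 / real CARD('n)))
            \<longleftrightarrow> dilatates K L \<or> L = {0}))"
proof -
  interpret convex_body K
    using assms interior_subset by unfold_locales auto
  \<comment> \<open>The two forms agree also when \<open>L\<close> has volume 0, since
    \<open>0 powr a = 0\<close>.\<close>
  have "(measure lebesgue L / measure lebesgue K) powr (1 / real CARD('n))
      = root DIM(real ^ 'n) (measure lebesgue L / measure lebesgue K)"
    by (simp add: root_powr_inverse)
  then show ?thesis
    using Orlicz_minkowski(1)[OF assms(5,6,8,2)] Orlicz_minkowski_equality[OF assms(5,6,8,2) _ assms(7)] by simp
qed

end
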